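(* Let $\phi\colon X\to X'$ be a quasi-isometric embedding between proper geodesic metric spaces. If $\phi(X)$ is contracting in $X'$, then the induced map $\partial_c\phi\colon \partial_c^{\mathcal{FQ}}X\to\partial_c^{\mathcal{FQ}}X'$ is an embedding (a homeomorphism onto its image with the subspace topology). In particular, if $\phi$ is a quasi-isometry then $\partial_c\phi$ is a homeomorphism.
   Context: A function $\rho\colon[0,\infty)\to\mathbb{R}$ is sublinear if it is non-decreasing, eventually non-negative, and $\lim_{r\to\infty}\rho(r)/r=0$. Let $X$ be a proper (closed balls are compact) geodesic metric space with metric $d$. For a closed subset $Z\subset X$ let $\pi_Z(x):=\{z\in Z\mid d(x,z)=d(x,Z)\}$. For sublinear $\rho$, $Z$ is $\rho$-contracting if for all $x,y\in X$: $d(x,y)\le d(x,Z)$ implies $\operatorname{diam}(\pi_Z(x)\cup\pi_Z(y))\le\rho(d(x,Z))$. $Z$ is contracting if it is $\rho$-contracting for some sublinear $\rho$. A subset that is not closed is called contracting if its closure is. For $L\ge1$, $A\ge0$, a map $\phi$ is an $(L,A)$-quasi-isometric embedding if $\frac1L d(x,y)-A\le d(\phi(x),\phi(y))\le Ld(x,y)+A$ for all $x,y$; it is a quasi-isometry if moreover every point of the target is within distance $A$ of the image. A geodesic is an isometric embedding of an interval, and an $(L,A)$-quasi-geodesic is an $(L,A)$-quasi-isometric embedding (not necessarily continuous) of an interval; a ray has domain $[0,\infty)$. Quasi-geodesics are conflated with their images, and a quasi-geodesic is contracting if its image is. Fix a basepoint $o\in X$. $\partial_cX$ is the set of contracting quasi-geodesic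 rays based at $o$ modulo finite Hausdorff distance. Every $\zeta\in\partial_cX$ contains a geodesic ray based at $o$; the function $\rho_\zeta(r):=\sup\operatorname{diam}(\pi_\alpha(x)\cup\pi_\alpha(y))$, with supremum over geodesic rays $\alpha\in\zeta$ (based at $o$) and points $x,y$ with $d(x,y)\le d(x,\alpha)\le r$, is sublinear and every geodesic in $\zeta$ is $\rho_\zeta$-contracting. For each $\zeta$ fix a geodesic ray $\alpha^\zeta\in\zeta$. For sublinear $\rho$, $L\ge1$, $A\ge0$ set $\kappa(\rho,L,A):=\max\{3A,\,3L^2,\,1+\inf\{R>0\mid\forall r\ge R,\ 3L^2\rho(r)\le r\}\}$. For $r\ge1$, $U(\zeta,r)$ is the set of $\eta\in\partial_cX$ such that for all $L\ge1$, $A\ge0$ and every continuous $(L,A)$-quasi-geodesic ray $\beta\in\eta$ (based at $o$) we have $d(\beta,\{x\in\alpha^\zeta\mid d(x,o)\ge r\})\le\kappa(\rho_\zeta,L,A)$. The topology of fellow-travelling quasi-geodesics is $\mathcal{FQ}:=\{U\subset\partial_cX\mid\forall\zeta\in U\ \exists r\ge1,\ U(\zeta,r)\subset U\}$, and $\partial_c^{\mathcal{FQ}}X$ is $\partial_cX$ with this topology (it does not depend, up to the natural identification, on the basepoint or on the chosen $\alpha^\zeta$). Take the basepoint of $X'$ to be $\phi(o)$. When $\phi(X)$ is contracting, $\phi$ takes contracting quasi-geodesic rays to contracting quasi-geodesic rays, and $\partial_c\phi$ is the map sending the class of a contracting quasi-geodesic ray $\gamma$ to the class of $\phi\circ\gamma$.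 *)

theory Defs
  imports "HOL-Analysis.Analysis"
begin

section \<open>Proper geodesic metric spaces\<close>

definition isometric_embedding_on :: "'a::metric_space set \<Rightarrow> ('a \<Rightarrow> 'b::metric_space) \<Rightarrow> bool" where
  "isometric_embedding_on S f \<longleftrightarrow> (\<forall>x\<in>S. \<forall>y\<in>S. dist (f x) (f y) = dist x y)"

class proper_geodesic_space = metric_space +
  assumes compact_cball_proper: "compact (cball x r)"
    and geodesic_joining:
      "\<exists>\<gamma>. isometric_embedding_on {0..dist x y} \<gamma> \<and> \<gamma> 0 = x \<and> \<gamma> (dist x y) = y"

instance proper_geodesic_space \<subseteq> heine_borel
proof
  fix f :: "nat \<Rightarrow> 'a"
  assume "bounded (range f)"
  then obtain x e where "range f \<subseteq> cball x e"
    by (meson bounded_subset_cball)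
  moreover have "seq_compact (cball x e)"
    using compact_cball_proper compact_imp_seq_compact by blast
  ultimately show "\<exists>l r. strict_mono r \<and> (f \<circ> r) \<longlonglongrightarrow> l"
    unfolding seq_compact_def by (meson range_subsetD)
qed


section \<open>Contracting sets\<close>

text \<open>Functions on \<open>[0,\<infinity>)\<close> are represented by functions on all reals whose values at
  negative arguments are irrelevant.\<close>

definition sublinear :: "(real \<Rightarrow> real) \<Rightarrow> bool" where
  "sublinear \<rho> \<longleftrightarrow>
     mono_on {0..} \<rho> \<and> (\<forall>\<^sub>F r in at_top. 0 \<le> \<rho> r) \<and> ((\<lambda>r. \<rho> r / r) \<longlongrightarrow> 0) at_top"

definition closest_proj :: "'a::metric_space set \<Rightarrow> 'a \<Rightarrow> 'a set" where
  "closest_proj Z x = {z \<in> Z. dist x z = infdist x Z}"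

definition rho_contracting :: "(real \<Rightarrow> real) \<Rightarrow> 'a::metric_space set \<Rightarrow> bool" where
  "rho_contracting \<rho> Z \<longleftrightarrow> closed Z \<and>
     (\<forall>x y. dist x y \<le> infdist x Z \<longrightarrow>
        diameter (closest_proj Z x \<union> closest_proj Z y) \<le> \<rho> (infdist x Z))"

definition contracting :: "'a::metric_space set \<Rightarrow> bool" where
  "contracting Z \<longleftrightarrow> (\<exists>\<rho>. sublinear \<rho> \<and> rho_contracting \<rho> (closure Z))"


section \<open>Quasi-isometries and quasi-geodesic rays\<close>

definition LA_qi_embedding_on ::
    "real \<Rightarrow> real \<Rightarrow> 'a::metric_space set \<Rightarrow> ('a \<Rightarrow> 'b::metric_space) \<Rightarrow> bool" where
  "LA_qi_embedding_on L A S f \<longleftrightarrow> L \<ge> 1 \<and> A \<ge> 0 \<and>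
     (\<forall>x\<in>S. \<forall>y\<in>S. 1 / L * dist x y - A \<le> dist (f x) (f y) \<and> dist (f x) (f y) \<le> L * dist x y + A)"

definition quasi_isometric_embedding :: "('a::metric_space \<Rightarrow> 'b::metric_space) \<Rightarrow> bool" where
  "quasi_isometric_embedding f \<longleftrightarrow> (\<exists>L A. LA_qi_embedding_on L A UNIV f)"

definition quasi_isometry :: "('a::metric_space \<Rightarrow> 'b::metric_space) \<Rightarrow> bool" where
  "quasi_isometry f \<longleftrightarrow>
     (\<exists>L A. LA_qi_embedding_on L A UNIV f \<and> (\<forall>y. infdist y (range f) \<le> A))"

text \<open>A ray is a function on the reals of which only the restriction to \<open>[0,\<infinity>)\<close> matters.
  In particular its image is \<open>\<gamma> ` {0..}\<close>.\<close>

definition geodesic_ray :: "'a::metric_space \<Rightarrow> (real \<Rightarrow> 'a) \<Rightarrow> bool" where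
  "geodesic_ray b \<gamma> \<longleftrightarrow> isometric_embedding_on {0..} \<gamma> \<and> \<gamma> 0 = b"

definition quasi_geodesic_ray :: "'a::metric_space \<Rightarrow> real \<Rightarrow> real \<Rightarrow> (real \<Rightarrow> 'a) \<Rightarrow> bool" where
  "quasi_geodesic_ray b L A \<gamma> \<longleftrightarrow> LA_qi_embedding_on L A {0..} \<gamma> \<and> \<gamma> 0 = b"

definition contracting_rays :: "'a::metric_space \<Rightarrow> (real \<Rightarrow> 'a) set" where
  "contracting_rays b = {\<gamma>. (\<exists>L A. quasi_geodesic_ray b L A \<gamma>) \<and> contracting (\<gamma> ` {0..})}"


section \<open>The contracting boundary\<close>

definition finite_hausdorff_distance :: "'a::metric_space set \<Rightarrow> 'a set \<Rightarrow> bool" where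
  "finite_hausdorff_distance S T \<longleftrightarrow>
     (\<exists>C. (\<forall>s\<in>S. \<exists>t\<in>T. dist s t \<le> C) \<and> (\<forall>t\<in>T. \<exists>s\<in>S. dist s t \<le> C))"

definition asymptotic :: "'a::metric_space \<Rightarrow> ((real \<Rightarrow> 'a) \<times> (real \<Rightarrow> 'a)) set" where
  "asymptotic b = {(\<beta>, \<gamma>). \<beta> \<in> contracting_rays b \<and> \<gamma> \<in> contracting_rays b \<and>
     finite_hausdorff_distance (\<beta> ` {0..}) (\<gamma> ` {0..})}"

definition contracting_boundary :: "'a::metric_space \<Rightarrow> (real \<Rightarrow> 'a) set set" where
  "contracting_boundary b = contracting_rays b // asymptotic b"

lemma finite_hausdorff_distance_refl: "finite_hausdorff_distance S S"
  unfolding finite_hausdorff_distance_def by (rule exI[of _ 0]) force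

lemma finite_hausdorff_distance_sym:
  "finite_hausdorff_distance S T \<Longrightarrow> finite_hausdorff_distance T S"
  unfolding finite_hausdorff_distance_def by (metis dist_commute)

lemma finite_hausdorff_distance_trans:
  assumes "finite_hausdorff_distance S T" and "finite_hausdorff_distance T U"
  shows "finite_hausdorff_distance S U"
proof -
  obtain C where C: "\<forall>s\<in>S. \<exists>t\<in>T. dist s t \<le> C" "\<forall>t\<in>T. \<exists>s\<in>S. dist s t \<le> C"
    using assms(1) unfolding finite_hausdorff_distance_def by blast
  obtain D where D: "\<forall>s\<in>T. \<exists>t\<in>U. dist s t \<le> D" "\<forall>t\<in>U. \<exists>s\<in>T. dist s t \<le> D"
    using assms(2) unfolding finite_hausdorff_distance_def by blast
  have add: "dist s u \<le> C + D" if "dist s t \<le> C" "dist t u \<le> D" for s t u :: 'a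
    using that dist_triangle[of s u t] by linarith
  show ?thesis
    unfolding finite_hausdorff_distance_def
    by (rule exI[of _ "C + D"]) (meson C D add)
qed

lemma equiv_asymptotic: "equiv (contracting_rays b) (asymptotic b)"
proof (rule equivI)
  show "asymptotic b \<subseteq> contracting_rays b \<times> contracting_rays b"
    by (auto simp: asymptotic_def)
  show "refl_on (contracting_rays b) (asymptotic b)"
    by (auto simp: refl_on_def asymptotic_def finite_hausdorff_distance_refl)
  show "sym (asymptotic b)"
    by (auto simp: sym_def asymptotic_def intro: finite_hausdorff_distance_sym)
  show "trans (asymptotic b)"
    unfolding trans_def asymptotic_def using finite_hausdorff_distance_trans by blast
qed

text \<open>The union below is the class of \<open>f \<circ> \<gamma>\<close> for any \<open>\<gamma> \<in> \<zeta>\<close>, as soon as \<open>f\<close> preserves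
  contracting rays; see \<open>boundary_map_eq\<close>.\<close>

definition boundary_map ::
    "'a::metric_space \<Rightarrow> ('a \<Rightarrow> 'b::metric_space) \<Rightarrow> (real \<Rightarrow> 'a) set \<Rightarrow> (real \<Rightarrow> 'b) set" where
  "boundary_map b f \<zeta> = (\<Union>\<gamma>\<in>\<zeta>. asymptotic (f b) `` {f \<circ> \<gamma>})"

lemma finite_hausdorff_distance_image:
  assumes "quasi_isometric_embedding f" and "finite_hausdorff_distance S T"
  shows "finite_hausdorff_distance (f ` S) (f ` T)"
proof -
  obtain L A where LA: "L \<ge> 1" "\<And>x y. dist (f x) (f y) \<le> L * dist x y + A"
    using assms(1) unfolding quasi_isometric_embedding_def LA_qi_embedding_on_def by auto
  obtain C where C: "\<forall>s\<in>S. \<exists>t\<in>T. dist s t \<le> C" "\<forall>t\<in>T. \<exists>s\<in>S. dist s t \<le> C"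
    using assms(2) unfolding finite_hausdorff_distance_def by blast
  have le: "dist (f x) (f y) \<le> L * C + A" if "dist x y \<le> C" for x y
    using LA(2)[of x y] mult_left_mono[OF that, of L] LA(1) by linarith
  show ?thesis
    unfolding finite_hausdorff_distance_def
    by (rule exI[of _ "L * C + A"]) (use C le in \<open>simp; meson\<close>)
qed

lemma boundary_map_eq:
  assumes f: "quasi_isometric_embedding f"
    and pres: "\<And>\<gamma>. \<gamma> \<in> contracting_rays b \<Longrightarrow> f \<circ> \<gamma> \<in> contracting_rays (f b)"
    and \<gamma>: "\<gamma> \<in> contracting_rays b"
  shows "boundary_map b f (asymptotic b `` {\<gamma>}) = asymptotic (f b) `` {f \<circ> \<gamma>}"
  unfolding boundary_map_def
proof (rule UN_equiv_class[OF equiv_asymptotic _ \<gamma>])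
  show "(\<lambda>\<gamma>. asymptotic (f b) `` {f \<circ> \<gamma>}) respects asymptotic b"
  proof (rule congruentI)
    fix \<beta> \<gamma>
    assume "(\<beta>, \<gamma>) \<in> asymptotic b"
    then have "(f \<circ> \<beta>, f \<circ> \<gamma>) \<in> asymptotic (f b)"
      using finite_hausdorff_distance_image[OF f] pres
      unfolding asymptotic_def mem_Collect_eq case_prod_conv image_comp[symmetric] by blast
    then show "asymptotic (f b) `` {f \<circ> \<beta>} = asymptotic (f b) `` {f \<circ> \<gamma>}"
      by (rule equiv_class_eq[OF equiv_asymptotic])
  qed
qed


section \<open>The topology of fellow-travelling quasi-geodesics\<close>

text \<open>For \<open>r \<ge> 0\<close> the diameters below are at most \<open>4 * r\<close>, so for a class \<open>\<zeta>\<close> containing a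
  geodesic ray this is a supremum of a nonempty bounded set of reals.\<close>

definition rho_class :: "'a::metric_space \<Rightarrow> (real \<Rightarrow> 'a) set \<Rightarrow> real \<Rightarrow> real" where
  "rho_class b \<zeta> r =
     Sup {diameter (closest_proj (\<alpha> ` {0..}) x \<union> closest_proj (\<alpha> ` {0..}) y) | \<alpha> x y.
            \<alpha> \<in> \<zeta> \<and> geodesic_ray b \<alpha> \<and>
            dist x y \<le> infdist x (\<alpha> ` {0..}) \<and> infdist x (\<alpha> ` {0..}) \<le> r}"

definition kappa :: "(real \<Rightarrow> real) \<Rightarrow> real \<Rightarrow> real \<Rightarrow> real" where
  "kappa \<rho> L A = Max {3 * A, 3 * L\<^sup>2, 1 + Inf {R. R > 0 \<and> (\<forall>r\<ge>R. 3 * L\<^sup>2 * \<rho> r \<le> r)}}"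

definition geodesic_choice :: "'a::metric_space \<Rightarrow> ((real \<Rightarrow> 'a) set \<Rightarrow> real \<Rightarrow> 'a) \<Rightarrow> bool" where
  "geodesic_choice b \<alpha> \<longleftrightarrow> (\<forall>\<zeta>\<in>contracting_boundary b. \<alpha> \<zeta> \<in> \<zeta> \<and> geodesic_ray b (\<alpha> \<zeta>))"

definition FQ_nbhd ::
    "'a::metric_space \<Rightarrow> ((real \<Rightarrow> 'a) set \<Rightarrow> real \<Rightarrow> 'a) \<Rightarrow> (real \<Rightarrow> 'a) set \<Rightarrow> real \<Rightarrow> (real \<Rightarrow> 'a) set set" where
  "FQ_nbhd b \<alpha> \<zeta> r =
     {\<eta> \<in> contracting_boundary b. \<forall>L\<ge>1. \<forall>A\<ge>0. \<forall>\<beta>\<in>\<eta>.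
        continuous_on {0..} \<beta> \<and> quasi_geodesic_ray b L A \<beta> \<longrightarrow>
        setdist (\<beta> ` {0..}) {x \<in> \<alpha> \<zeta> ` {0..}. dist x b \<ge> r} \<le> kappa (rho_class b \<zeta>) L A}"

definition FQ_topology ::
    "'a::metric_space \<Rightarrow> ((real \<Rightarrow> 'a) set \<Rightarrow> real \<Rightarrow> 'a) \<Rightarrow> (real \<Rightarrow> 'a) set topology" where
  "FQ_topology b \<alpha> =
     topology (\<lambda>U. U \<subseteq> contracting_boundary b \<and> (\<forall>\<zeta>\<in>U. \<exists>r\<ge>1. FQ_nbhd b \<alpha> \<zeta> r \<subseteq> U))"

lemma FQ_nbhd_mono:
  assumes \<alpha>: "geodesic_choice b \<alpha>" and \<zeta>: "\<zeta> \<in> contracting_boundary b" and "r \<le> s"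
  shows "FQ_nbhd b \<alpha> \<zeta> s \<subseteq> FQ_nbhd b \<alpha> \<zeta> r"
proof -
  let ?tail = "\<lambda>r. {x \<in> \<alpha> \<zeta> ` {0..}. dist x b \<ge> r}"
  have "geodesic_ray b (\<alpha> \<zeta>)"
    using \<alpha> \<zeta> by (auto simp: geodesic_choice_def)
  then have "dist (\<alpha> \<zeta> (max 0 s)) b = max 0 s"
    unfolding geodesic_ray_def isometric_embedding_on_def
    by (metis abs_of_nonneg atLeast_iff dist_0_norm dist_commute max.cobounded1 order_refl real_norm_def)
  then have "\<alpha> \<zeta> (max 0 s) \<in> ?tail s"
    by auto
  then have "setdist B (?tail r) \<le> setdist B (?tail s)" for B
    using \<open>r \<le> s\<close> by (intro setdist_subset_right) auto
  then show ?thesis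
    unfolding FQ_nbhd_def by (blast intro: order_trans)
qed

lemma openin_FQ_topology:
  assumes \<alpha>: "geodesic_choice b \<alpha>"
  shows "openin (FQ_topology b \<alpha>) U \<longleftrightarrow>
    U \<subseteq> contracting_boundary b \<and> (\<forall>\<zeta>\<in>U. \<exists>r\<ge>1. FQ_nbhd b \<alpha> \<zeta> r \<subseteq> U)"
proof -
  let ?open = "\<lambda>U. U \<subseteq> contracting_boundary b \<and> (\<forall>\<zeta>\<in>U. \<exists>r\<ge>1. FQ_nbhd b \<alpha> \<zeta> r \<subseteq> U)"
  have "?open (S \<inter> T)" if S: "?open S" and T: "?open T" for S T
  proof (intro conjI ballI)
    fix \<zeta> assume \<zeta>: "\<zeta> \<in> S \<inter> T"
    then obtain r s where "r \<ge> 1" "FQ_nbhd b \<alpha> \<zeta> r \<subseteq> S" "s \<ge> 1" "FQ_nbhd b \<alpha> \<zeta> s \<subseteq> T"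
      using S T by blast
    moreover have "\<zeta> \<in> contracting_boundary b"
      using \<zeta> S by blast
    ultimately show "\<exists>r\<ge>1. FQ_nbhd b \<alpha> \<zeta> r \<subseteq> S \<inter> T"
      using FQ_nbhd_mono[OF \<alpha>, of \<zeta> r "max r s"] FQ_nbhd_mono[OF \<alpha>, of \<zeta> s "max r s"]
      by (intro exI[of _ "max r s"]) auto
  qed (use S in blast)
  moreover have "?open (\<Union>\<K>)" if "\<forall>K\<in>\<K>. ?open K" for \<K>
    using that by (meson Sup_least Union_iff Union_upper order_trans)
  ultimately have "istopology ?open"
    unfolding istopology_def by blast
  then show ?thesis
    by (simp add: FQ_topology_def topology_inverse')
qed

lemma topspace_FQ_topology:
  assumes "geodesic_choice b \<alpha>"
  shows "topspace (FQ_topology b \<alpha>) = contracting_boundary b"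
proof -
  have "openin (FQ_topology b \<alpha>) (contracting_boundary b)"
    unfolding openin_FQ_topology[OF assms] by (auto simp: FQ_nbhd_def intro: exI[of _ 1])
  then show ?thesis
    by (meson openin_FQ_topology[OF assms] openin_subset openin_topspace subset_antisym)
qed

end

(* Contraction of a set Z can be recognised from any coarse projection P to Z that moves points at
   height h = d(x,Z) by o(h) under displacements of size comparable to h: following a geodesic from
   x to one of its closest points z shows that P x is within o(h) of z. Such projections can be
   transported along quasi-isometric embeddings in both directions and to sets at finite Hausdorff
   distance, so no detour through Morse sets is needed.

   A quasi-geodesic at distance at least kappa from a contracting set spends an amount of time there
   that is linear in the heights of its end points. Hence quasi-geodesics near the contracting set
   phi(X) stay uniformly close to it and lift to X, and a quasi-geodesic that is within any fixed
   distance of the geodesic of zeta sufficiently far out is within kappa of it beyond r. Since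
   U(zeta,r) only constrains (L,A) with 3 L^2, 3 A < r, the resulting bounds are uniform, which gives
   continuity of the boundary map and of its inverse. Openness onto the image then follows because
   the image is closed: a geodesic that returns to a fixed neighbourhood of phi(X) arbitrarily far
   out stays near phi(X), so it lifts. *)
theory Submission
  imports Defs
begin

section \<open>Closest-point projections\<close>

text \<open>Nothing here says that a set U(zeta,r) is itself open, so including the trace of U'(F
  zeta,R) on the image in F(W) does not yet exhibit F(W) as the trace of an open set. The candidate
  that needs only such inclusions is F(W) together with the whole complement of the image;
  closedness of the image supplies its openness at points off the image. Uniformity is the second
  obstacle. \<open>rho_class\<close> is a supremum over all geodesics of a class, and lying in a
  class gives a finite Hausdorff distance of unknown size. Coarse contraction is therefore stated
  for families with common constants, and unknown bounds are replaced by uniform ones once a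
  quasi-geodesic is known to return to height kappa. The inequalities 3A <= h and 3 L^2 rho(h) <= h
  behind kappa make the projection of an (L,A)-quasi-geodesic at height h advance at rate at most
  1/(2L), half the coarse rate 1/L of the quasi-geodesic itself. Composites with phi may be
  discontinuous while U(zeta,r) tests only continuous rays; geodesic interpolation bridges this at
  bounded cost.\<close>

lemma closest_proj_nonempty:
  fixes Z :: "'a::heine_borel set"
  assumes "closed Z" "Z \<noteq> {}"
  shows "closest_proj Z x \<noteq> {}"
proof -
  obtain z where z: "z \<in> Z" "\<And>y. y \<in> Z \<Longrightarrow> dist x z \<le> dist x y"
    using distance_attains_inf[OF assms] by metis
  have "dist x z \<le> infdist x Z"
    unfolding infdist_notempty[OF assms(2)] using assms(2) z by (intro cINF_greatest) auto
  then have "dist x z = infdist x Z"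
    using infdist_le[OF z(1)] by (meson order_antisym)
  then show ?thesis using z by (auto simp: closest_proj_def)
qed

lemma bounded_closest_proj: "bounded (closest_proj Z x)"
  by (rule bounded_subset[OF bounded_cball[of x "infdist x Z"]]) (auto simp: closest_proj_def)

lemma infdist_closure [simp]: "infdist x (closure Z) = infdist x Z"
  by (simp add: infdist_eq_setdist)

lemma infdist_less_obtain:
  assumes "infdist x Z < e" "Z \<noteq> {}"
  obtains z where "z \<in> Z" "dist x z < e"
  using setdist_ltE[of "{x}" Z e] assms by (auto simp: infdist_eq_setdist)

lemma infdist_triangle': "infdist y Z \<le> infdist x Z + dist x y"
  using infdist_triangle[of y Z x] by (simp add: dist_commute)

text \<open>With h the height of x, the height of y is at most 2h. Two closest points of y are thus
  within 4h of each other, and a closest point of x and one of y within h + h + 2h. This crude bound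
  makes the suprema below finite and handles low points.\<close>

lemma dist_closest_proj_le:
  assumes "dist x y \<le> infdist x Z"
    and "z \<in> closest_proj Z x \<union> closest_proj Z y" "w \<in> closest_proj Z x \<union> closest_proj Z y"
  shows "dist z w \<le> 4 * infdist x Z"
proof -
  have *: "dist u v \<le> 4 * infdist x Z"
    if "u \<in> closest_proj Z x \<and> v \<in> closest_proj Z x \<or> u \<in> closest_proj Z x \<and> v \<in> closest_proj Z y
      \<or> u \<in> closest_proj Z y \<and> v \<in> closest_proj Z y" for u v
    using that assms(1) infdist_triangle'[of y Z x] infdist_nonneg[of x Z]
      dist_triangle2[of u v x] dist_triangle2[of u v y] dist_triangle[of x v y]
    by (auto simp: closest_proj_def dist_commute)
  show ?thesis
    using *[of z w] *[of w z] assms(2,3) by (auto simp: dist_commute)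
qed

lemma diameter_least:
  assumes "S \<noteq> {}" "\<And>x y. x \<in> S \<Longrightarrow> y \<in> S \<Longrightarrow> dist x y \<le> d"
  shows "diameter S \<le> d"
  unfolding diameter_def using assms by (auto intro!: cSUP_least)

text \<open>This is the supremum in \<open>rho_class\<close>, taken over an arbitrary family of sets
  instead of the images of the geodesic rays in a class.\<close>

definition sup_diam :: "'a::metric_space set set \<Rightarrow> real \<Rightarrow> real" where
  "sup_diam \<Z> r = Sup {diameter (closest_proj Z x \<union> closest_proj Z y) | Z x y.
     Z \<in> \<Z> \<and> dist x y \<le> infdist x Z \<and> infdist x Z \<le> r}"

text \<open>The threshold \<open>D\<close> in the smallness hypothesis is common to all members of
  the family. Points above height \<open>D\<close> contribute at most a small multiple of their
  height, and points below it at most \<open>4 * D\<close> in total, which is negligible against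
  large \<open>r\<close>.\<close>

lemma sublinear_sup_diam:
  fixes \<Z> :: "'a::heine_borel set set"
  assumes ne: "\<Z> \<noteq> {}" and cl: "\<And>Z. Z \<in> \<Z> \<Longrightarrow> closed Z" "\<And>Z. Z \<in> \<Z> \<Longrightarrow> Z \<noteq> {}"
    and small: "\<And>\<epsilon>. \<epsilon> > 0 \<Longrightarrow> \<exists>D. \<forall>Z\<in>\<Z>. \<forall>x y z w. D \<le> infdist x Z \<longrightarrow> dist x y \<le> infdist x Z \<longrightarrow>
      z \<in> closest_proj Z x \<union> closest_proj Z y \<longrightarrow> w \<in> closest_proj Z x \<union> closest_proj Z y \<longrightarrow>
      dist z w \<le> \<epsilon> * infdist x Z"
  shows "sublinear (sup_diam \<Z>)" and "\<And>Z. Z \<in> \<Z> \<Longrightarrow> rho_contracting (sup_diam \<Z>) Z"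
proof -
  define S where "S r = {diameter (closest_proj Z x \<union> closest_proj Z y) | Z x y.
     Z \<in> \<Z> \<and> dist x y \<le> infdist x Z \<and> infdist x Z \<le> r}" for r
  have eq: "sup_diam \<Z> r = Sup (S r)" for r by (simp add: sup_diam_def S_def)
  have pne: "closest_proj Z x \<union> closest_proj Z y \<noteq> {}" if "Z \<in> \<Z>" for Z x y
    using closest_proj_nonempty[OF cl[OF that], of x] by auto
  have bd4: "s \<le> 4 * r" if s: "s \<in> S r" for s r
  proof -
    obtain Z x y where Z: "Z \<in> \<Z>" "dist x y \<le> infdist x Z" "infdist x Z \<le> r"
        "s = diameter (closest_proj Z x \<union> closest_proj Z y)"
      using s unfolding S_def by blast
    have "s \<le> 4 * infdist x Z"
      unfolding Z(4)
      by (rule diameter_least[OF pne[OF Z(1)]]) (rule dist_closest_proj_le[OF Z(2)])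
    then show ?thesis using Z(3) by linarith
  qed
  have bdd: "bdd_above (S r)" for r
    using bd4 by (intro bdd_aboveI) auto
  have S_ne: "S r \<noteq> {}" and S_nonneg: "0 \<le> Sup (S r)" if "0 \<le> r" for r
  proof -
    obtain Z z where Z: "Z \<in> \<Z>" "z \<in> Z" using ne cl by blast
    have m: "diameter (closest_proj Z z \<union> closest_proj Z z) \<in> S r"
      unfolding S_def using Z that by (auto intro!: exI[of _ Z] exI[of _ z])
    then show "S r \<noteq> {}" by blast
    have "0 \<le> diameter (closest_proj Z z \<union> closest_proj Z z)"
      by (intro diameter_ge_0) (simp add: bounded_closest_proj)
    also have "\<dots> \<le> Sup (S r)" by (rule cSup_upper[OF m bdd])
    finally show "0 \<le> Sup (S r)" .
  qed
  show "sublinear (sup_diam \<Z>)"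
    unfolding sublinear_def
  proof (intro conjI)
    show "mono_on {0..} (sup_diam \<Z>)"
      unfolding eq
      by (intro mono_onI cSup_subset_mono S_ne bdd) (auto simp: S_def, force)
    show "\<forall>\<^sub>F r in at_top. 0 \<le> sup_diam \<Z> r"
      unfolding eq using eventually_ge_at_top[of 0] by eventually_elim (rule S_nonneg)
    show "((\<lambda>r. sup_diam \<Z> r / r) \<longlongrightarrow> 0) at_top"
    proof (rule tendstoI)
      fix e :: real assume e: "e > 0"
      obtain D where D: "\<And>Z x y z w. Z \<in> \<Z> \<Longrightarrow> D \<le> infdist x Z \<Longrightarrow> dist x y \<le> infdist x Z \<Longrightarrow>
        z \<in> closest_proj Z x \<union> closest_proj Z y \<Longrightarrow> w \<in> closest_proj Z x \<union> closest_proj Z y \<Longrightarrow>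
        dist z w \<le> e/2 * infdist x Z"
        using small[of "e/2"] e by auto blast
      show "\<forall>\<^sub>F r in at_top. dist (sup_diam \<Z> r / r) 0 < e"
        \<comment> \<open>From here on \<open>4 * D\<close>, the contribution of points below height
          \<open>D\<close>, is at most \<open>e/2 * r\<close>.\<close>
        using eventually_ge_at_top[of "max 1 (8 * D / e)"]
      proof eventually_elim
        case (elim r)
        then have r: "r \<ge> 1" "4 * D \<le> e/2 * r" using e by (auto simp: field_simps)
        have "s \<le> e/2 * r" if s: "s \<in> S r" for s
        proof -
          obtain Z x y where Z: "Z \<in> \<Z>" "dist x y \<le> infdist x Z" "infdist x Z \<le> r"
              "s = diameter (closest_proj Z x \<union> closest_proj Z y)"
            using s unfolding S_def by blast
          have "dist z w \<le> e/2 * r"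
            if zw: "z \<in> closest_proj Z x \<union> closest_proj Z y" "w \<in> closest_proj Z x \<union> closest_proj Z y"
            for z w
          proof (cases "D \<le> infdist x Z")
            case True
            then have "dist z w \<le> e/2 * infdist x Z" using D Z zw by blast
            also have "\<dots> \<le> e/2 * r" using Z e by simp
            finally show ?thesis .
          next
            case False
            then show ?thesis using dist_closest_proj_le[OF Z(2) zw] r by linarith
          qed
          then show ?thesis
            unfolding Z(4) using pne[OF Z(1)] by (intro diameter_least) auto
        qed
        then have "Sup (S r) \<le> e/2 * r" using S_ne r by (intro cSup_least) auto
        moreover have "0 \<le> Sup (S r)" using S_nonneg r by auto
        moreover have "0 < e * r" using r e by simp
        ultimately have "0 \<le> Sup (S r)" "Sup (S r) < e * r" by linarith+
        then show ?case
          using r e by (auto simp: eq field_simps)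
      qed
    qed
  qed
  show "rho_contracting (sup_diam \<Z>) Z" if "Z \<in> \<Z>" for Z
    unfolding rho_contracting_def
  proof (intro conjI allI impI)
    fix x y assume "dist x y \<le> infdist x Z"
    then have "diameter (closest_proj Z x \<union> closest_proj Z y) \<in> S (infdist x Z)"
      unfolding S_def using that by blast
    then show "diameter (closest_proj Z x \<union> closest_proj Z y) \<le> sup_diam \<Z> (infdist x Z)"
      unfolding eq by (rule cSup_upper[OF _ bdd])
  qed (use cl that in auto)
qed

lemma sublinear_eventually_le:
  assumes "sublinear \<rho>" "\<epsilon> > 0"
  shows "\<exists>D\<ge>1. \<forall>r\<ge>D. \<rho> r \<le> \<epsilon> * r"
proof -
  have "\<forall>\<^sub>F r in at_top. dist (\<rho> r / r) 0 < \<epsilon>"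
    using assms unfolding sublinear_def by (auto dest: tendstoD)
  then obtain D where D: "\<And>r. r \<ge> D \<Longrightarrow> dist (\<rho> r / r) 0 < \<epsilon>"
    by (auto simp: eventually_at_top_linorder)
  have "\<rho> r \<le> \<epsilon> * r" if "r \<ge> max 1 D" for r
    using D[of r] that by (auto simp: field_simps abs_less_iff)
  then show ?thesis by (intro exI[of _ "max 1 D"]) auto
qed

lemma rho_contractingD:
  assumes "rho_contracting \<rho> Z" "dist x y \<le> infdist x Z"
    and "z \<in> closest_proj Z x \<union> closest_proj Z y" "w \<in> closest_proj Z x \<union> closest_proj Z y"
  shows "dist z w \<le> \<rho> (infdist x Z)"
proof -
  have "dist z w \<le> diameter (closest_proj Z x \<union> closest_proj Z y)"
    using assms(3,4) by (intro diameter_bounded_bound) (auto simp: bounded_closest_proj)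
  then show ?thesis using assms(1,2) unfolding rho_contracting_def by force
qed

section \<open>Coarse contractions\<close>

text \<open>The constants are common to the family, because \<open>rho_class\<close> takes a
  supremum over many rays at once. \<open>P\<close> is tied to \<open>Z\<close> only through the
  linear bound on how far it moves points, so one \<open>P\<close> can serve several sets at finite
  Hausdorff distance. The scale \<open>K\<close> in the second clause leaves room for the distortion
  of a quasi-isometric embedding.\<close>

definition coarse_contraction :: "('a::metric_space set \<times> ('a \<Rightarrow> 'a)) set \<Rightarrow> bool" where
  "coarse_contraction F \<longleftrightarrow>
     (\<exists>K\<ge>1. \<forall>Z P x. (Z, P) \<in> F \<longrightarrow> dist (P x) x \<le> K * (infdist x Z + 1)) \<and>
     (\<exists>K\<ge>1. \<forall>\<epsilon>>0. \<exists>R. \<forall>Z P x y. (Z, P) \<in> F \<longrightarrow> R \<le> infdist x Z \<longrightarrow> K * dist x y \<le> infdist x Z \<longrightarrow>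
        dist (P x) (P y) \<le> \<epsilon> * infdist x Z)"

text \<open>Walk from x to y along a geodesic in boundedly many steps short enough for the second
  clause. Either every sample stays above a small fraction of the initial height h, and the small
  displacements add up, or some sample drops below it. In that case nearly all of the length, which
  is at most h, has been used up, so y is close to the sample and both are low, where
  \<open>P\<close> moves points little.\<close>

lemma coarse_contraction_unit_scale:
  fixes F :: "('a::proper_geodesic_space set \<times> ('a \<Rightarrow> 'a)) set"
  assumes F: "coarse_contraction F" and \<epsilon>: "\<epsilon> > 0"
  shows "\<exists>D. \<forall>Z P x y. (Z, P) \<in> F \<longrightarrow> D \<le> infdist x Z \<longrightarrow> dist x y \<le> infdist x Z \<longrightarrow>
    dist (P x) (P y) \<le> \<epsilon> * infdist x Z"
proof -
  obtain K1 where K1: "K1 \<ge> 1" "\<And>Z P x. (Z, P) \<in> F \<Longrightarrow> dist (P x) x \<le> K1 * (infdist x Z + 1)"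
    using F unfolding coarse_contraction_def by metis
  obtain K2 where K2: "K2 \<ge> 1" "\<And>\<epsilon>. \<epsilon> > 0 \<Longrightarrow> \<exists>R. \<forall>Z P x y. (Z, P) \<in> F \<longrightarrow> R \<le> infdist x Z \<longrightarrow>
     K2 * dist x y \<le> infdist x Z \<longrightarrow> dist (P x) (P y) \<le> \<epsilon> * infdist x Z"
    using F unfolding coarse_contraction_def by metis
  \<comment> \<open>The budget \<open>\<epsilon> * h\<close> is split in halves. The
    \<open>N\<close> steps cost at most \<open>2 * \<delta> * h\<close> each, together
    \<open>\<epsilon> / 2 * h\<close>. The jump from a low sample to y costs at most
    \<open>4 * (K1 * (\<eta> * h)) + 2 * K1\<close>, which is at most the other half by the choice
    of \<open>\<eta>\<close> and the entry \<open>8 * K1 / \<epsilon>\<close> of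
    \<open>D\<close>.\<close>
  define \<eta> where "\<eta> = min (1/2) (\<epsilon> / (16 * K1))"
  have \<eta>: "\<eta> > 0" "\<eta> \<le> 1/2" "16 * K1 * \<eta> \<le> \<epsilon>"
    using \<epsilon> K1(1) by (auto simp: \<eta>_def min_def field_simps)
  define N where "N = nat \<lceil>K2 / \<eta>\<rceil>"
  have "K2 / \<eta> \<le> N" unfolding N_def by (rule real_nat_ceiling_ge)
  then have N: "K2 \<le> N * \<eta>" using \<eta> by (simp add: field_simps)
  then have "N > 0" using K2(1) \<eta> by (cases N) auto
  define \<delta> where "\<delta> = \<epsilon> / (4 * N)"
  have \<delta>: "\<delta> > 0" "N * (2 * \<delta>) = \<epsilon> / 2" using \<epsilon> \<open>N > 0\<close> by (auto simp: \<delta>_def field_simps)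
  obtain R where R: "\<And>Z P x y. (Z, P) \<in> F \<Longrightarrow> R \<le> infdist x Z \<Longrightarrow>
     K2 * dist x y \<le> infdist x Z \<Longrightarrow> dist (P x) (P y) \<le> \<delta> * infdist x Z"
    using K2(2)[OF \<delta>(1)] by metis
  define D where "D = max (R / \<eta>) (8 * K1 / \<epsilon>)"
  have "dist (P x) (P y) \<le> \<epsilon> * infdist x Z"
    if ZP: "(Z, P) \<in> F" and x: "D \<le> infdist x Z" and xy: "dist x y \<le> infdist x Z" for Z P x y
  proof -
    define h where "h = infdist x Z"
    have h: "R \<le> \<eta> * h" "8 * K1 \<le> \<epsilon> * h" "dist x y \<le> h" "h \<ge> 0"
      using x xy \<eta> \<epsilon> by (auto simp: D_def h_def field_simps infdist_nonneg)
    obtain g where g: "isometric_embedding_on {0..dist x y} g" "g 0 = x" "g (dist x y) = y"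
      using geodesic_joining by blast
    define s where "s = \<eta> * h / K2"
    have "K2 * h \<le> (real N * \<eta>) * h"
      using N h(4) by (rule mult_right_mono)
    then have s: "s \<ge> 0" "K2 * s = \<eta> * h" "h \<le> N * s"
      using \<eta> K2(1) h(4) by (auto simp: s_def field_simps)
    define p where "p i = g (min (real i * s) (dist x y))" for i :: nat
    have p_dist: "dist (g a) (g c) = \<bar>a - c\<bar>" if "0 \<le> a" "a \<le> dist x y" "0 \<le> c" "c \<le> dist x y" for a c
      using g(1) that unfolding isometric_embedding_on_def by (simp add: dist_real_def)
    have xp: "dist x (p i) \<le> h" and py: "dist (p i) y = dist x y - dist x (p i)" for i
      using p_dist[of 0 "min (real i * s) (dist x y)"] p_dist[of "min (real i * s) (dist x y)" "dist x y"]
        g s h by (auto simp: p_def)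
    have pp: "dist (p i) (p (Suc i)) \<le> s" for i
      using p_dist[of "min (real i * s) (dist x y)" "min (real (Suc i) * s) (dist x y)"] s
      by (auto simp: p_def algebra_simps min_def)
    have p0: "p 0 = x" by (simp add: p_def g)
    have pN: "p N = y" using s h(3) by (simp add: p_def g min_absorb2)
    have hp: "infdist (p i) Z \<le> 2 * h" for i
      using infdist_triangle'[of "p i" Z x] xp[of i] by (simp add: h_def)
    have walk: "dist (P x) (P (p i)) \<le> i * (2 * \<delta> * h)" if "\<forall>j<i. \<eta> * h \<le> infdist (p j) Z" for i
      using that
    proof (induction i)
      case 0 then show ?case by (simp add: p0)
    next
      case (Suc i)
      have a: "\<eta> * h \<le> infdist (p i) Z" using Suc.prems by blast
      have "K2 * dist (p i) (p (Suc i)) \<le> K2 * s" using pp[of i] K2(1) by simp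
      then have "dist (P (p i)) (P (p (Suc i))) \<le> \<delta> * infdist (p i) Z"
        using a s(2) h(1) by (intro R[OF ZP]) linarith+
      also have "\<dots> \<le> \<delta> * (2 * h)" using hp[of i] \<delta> by simp
      finally have "dist (P (p i)) (P (p (Suc i))) \<le> 2 * \<delta> * h" by simp
      moreover have "dist (P x) (P (p i)) \<le> i * (2 * \<delta> * h)" using Suc by auto
      ultimately show ?case
        using dist_triangle[of "P x" "P (p (Suc i))" "P (p i)"] by (simp add: algebra_simps)
    qed
    have walk': "dist (P x) (P (p i)) \<le> \<epsilon> / 2 * h" if "\<forall>j<i. \<eta> * h \<le> infdist (p j) Z" "i \<le> N" for i
    proof -
      have "i * (2 * \<delta> * h) \<le> N * (2 * \<delta> * h)" using that(2) \<delta> h by (intro mult_right_mono) auto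
      also have "\<dots> = \<epsilon> / 2 * h" using \<delta>(2) by (metis mult.assoc)
      finally show ?thesis using walk[OF that(1)] by linarith
    qed
    show ?thesis
    proof (cases "\<forall>j<N. \<eta> * h \<le> infdist (p j) Z")
      case True
      have "\<epsilon> / 2 * h \<le> \<epsilon> * h" using \<epsilon> h by simp
      then show ?thesis using walk'[OF True order_refl] pN h_def by simp
    next
      case False
      define i where "i = (LEAST j. infdist (p j) Z < \<eta> * h)"
      obtain j where j: "j < N" "infdist (p j) Z < \<eta> * h" using False by force
      then have i: "infdist (p i) Z < \<eta> * h" "i \<le> j" "\<forall>k<i. \<eta> * h \<le> infdist (p k) Z"
        unfolding i_def by (auto intro: LeastI Least_le dest: not_less_Least simp: not_less[symmetric])
      \<comment> \<open>A drop in height from \<open>h\<close> to below \<open>\<eta> * h\<close>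
        uses more than \<open>h - \<eta> * h\<close> of the geodesic, whose length is at most
        \<open>h\<close>.\<close>
      have near: "dist (p i) y \<le> \<eta> * h"
        using infdist_triangle[of x Z "p i"] i(1) py[of i] h(3) by (simp add: h_def)
      then have hy: "infdist y Z \<le> 2 * (\<eta> * h)"
        using infdist_triangle'[of y Z "p i"] i(1) by linarith
      have "dist (P (p i)) (p i) \<le> K1 * (\<eta> * h + 1)"
        using K1(2)[OF ZP, of "p i"] mult_left_mono[of "infdist (p i) Z + 1" "\<eta> * h + 1" K1] i(1) K1(1)
        by linarith
      moreover have "dist (P y) y \<le> K1 * (2 * (\<eta> * h) + 1)"
        using K1(2)[OF ZP, of y] mult_left_mono[of "infdist y Z + 1" "2 * (\<eta> * h) + 1" K1] hy K1(1)
        by linarith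
      moreover have "dist (P (p i)) (P y) \<le> dist (P (p i)) (p i) + dist (p i) y + dist (P y) y"
        using dist_triangle[of "P (p i)" "P y" "p i"] dist_triangle2[of "p i" "P y" y]
        by (simp add: dist_commute)
      moreover have "\<eta> * h \<le> K1 * (\<eta> * h)" using K1(1) \<eta> h mult_right_mono[of 1 K1 "\<eta> * h"] by simp
      ultimately have "dist (P (p i)) (P y) \<le> 4 * (K1 * (\<eta> * h)) + 2 * K1"
        using near by (simp add: algebra_simps)
      moreover have "16 * K1 * \<eta> * h \<le> \<epsilon> * h" using \<eta>(3) h(4) by (rule mult_right_mono)
      moreover have "dist (P x) (P (p i)) \<le> \<epsilon> / 2 * h" using walk'[of i] i j by auto
      ultimately show ?thesis
        using dist_triangle[of "P x" "P y" "P (p i)"] h(2) by (simp add: h_def)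
    qed
  qed
  then show ?thesis by blast
qed

lemma coarse_contractionI:
  assumes "K1 \<ge> 1" "\<And>Z P x. (Z, P) \<in> F \<Longrightarrow> dist (P x) x \<le> K1 * (infdist x Z + 1)"
    and "K2 \<ge> 1" "\<And>\<epsilon>. \<epsilon> > 0 \<Longrightarrow> \<exists>R. \<forall>Z P x y. (Z, P) \<in> F \<longrightarrow> R \<le> infdist x Z \<longrightarrow>
      K2 * dist x y \<le> infdist x Z \<longrightarrow> dist (P x) (P y) \<le> \<epsilon> * infdist x Z"
  shows "coarse_contraction F"
  using assms unfolding coarse_contraction_def by blast

text \<open>A closest point u of v is at distance exactly the height of v, so the unit-scale
  estimate applies to the pair v, u; since u lies on \<open>Z\<close>, \<open>P u\<close> is within
  \<open>K\<close> of u. Hence \<open>P v\<close> is close to every closest point of v. This needs v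
  to be high; if y happens to be low, \<open>P y\<close>, y and its closest points are all within a
  constant of each other.\<close>

lemma coarse_contraction_closest_proj:
  fixes F :: "('a::proper_geodesic_space set \<times> ('a \<Rightarrow> 'a)) set"
  assumes F: "coarse_contraction F" and \<epsilon>: "\<epsilon> > 0"
  shows "\<exists>D. \<forall>Z P x y z w. (Z, P) \<in> F \<longrightarrow> D \<le> infdist x Z \<longrightarrow> dist x y \<le> infdist x Z \<longrightarrow>
    z \<in> closest_proj Z x \<union> closest_proj Z y \<longrightarrow> w \<in> closest_proj Z x \<union> closest_proj Z y \<longrightarrow>
    dist z w \<le> \<epsilon> * infdist x Z"
proof -
  obtain K where K: "K \<ge> 1" "\<And>Z P x. (Z, P) \<in> F \<Longrightarrow> dist (P x) x \<le> K * (infdist x Z + 1)"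
    using F unfolding coarse_contraction_def by metis
  \<comment> \<open>Each closest point is within \<open>3 * (\<delta> * h)\<close> of
    \<open>P x\<close> or \<open>P y\<close>, and these two are within \<open>\<delta> * h\<close>
    of each other. So z and w are both within \<open>4 * (\<delta> * h)\<close> of
    \<open>P x\<close>.\<close>
  define \<delta> where "\<delta> = \<epsilon> / 8"
  have \<delta>: "\<delta> > 0" using \<epsilon> by (simp add: \<delta>_def)
  obtain D where D: "\<And>Z P x y. (Z, P) \<in> F \<Longrightarrow> D \<le> infdist x Z \<Longrightarrow> dist x y \<le> infdist x Z \<Longrightarrow>
    dist (P x) (P y) \<le> \<delta> * infdist x Z"
    using coarse_contraction_unit_scale[OF F \<delta>] by metis
  define D' where "D' = max (max 0 D) ((K * (\<bar>D\<bar> + 1) + \<bar>D\<bar>) / \<delta>)"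
  have D': "D' \<ge> 0" "D' \<ge> D" "K * (\<bar>D\<bar> + 1) + \<bar>D\<bar> \<le> \<delta> * D'"
    using \<delta> pos_divide_le_eq[OF \<delta>, of "K * (\<bar>D\<bar> + 1) + \<bar>D\<bar>" D']
    by (simp_all add: D'_def le_max_iff_disj mult.commute)
  have "dist z w \<le> \<epsilon> * infdist x Z"
    if ZP: "(Z, P) \<in> F" and x: "D' \<le> infdist x Z" and xy: "dist x y \<le> infdist x Z"
      and z: "z \<in> closest_proj Z x \<union> closest_proj Z y" and w: "w \<in> closest_proj Z x \<union> closest_proj Z y"
    for Z P x y z w
  proof -
    define h where "h = infdist x Z"
    have h: "K * (\<bar>D\<bar> + 1) + \<bar>D\<bar> \<le> \<delta> * h" "D \<le> h" "dist x y \<le> h" "0 \<le> h"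
    proof -
      have "\<delta> * D' \<le> \<delta> * h" using x \<delta> by (simp add: h_def)
      then show "K * (\<bar>D\<bar> + 1) + \<bar>D\<bar> \<le> \<delta> * h" using D'(3) by linarith
    qed (use x D' xy in \<open>auto simp: h_def infdist_nonneg\<close>)
    have "K \<le> K * (\<bar>D\<bar> + 1)" using K(1) by (simp add: algebra_simps)
    then have Kh: "K \<le> \<delta> * h" using h by linarith
    have hy: "infdist y Z \<le> 2 * h"
      using infdist_triangle'[of y Z x] h by (simp add: h_def)
    have PZ: "dist (P u) u \<le> \<delta> * h" if "u \<in> Z" for u
      using K(2)[OF ZP, of u] that Kh by simp
    have far: "dist (P v) u \<le> \<delta> * infdist v Z + \<delta> * h"
      if "u \<in> closest_proj Z v" "D \<le> infdist v Z" for u v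
      using D[OF ZP that(2), of u] PZ[of u] dist_triangle[of "P v" u "P u"] that(1)
      by (auto simp: closest_proj_def)
    have near: "dist (P v) u \<le> \<delta> * h"
      if "u \<in> closest_proj Z v" "infdist v Z < D" for u v
    proof -
      have "dist (P v) v \<le> K * (infdist v Z + 1)" using K(2)[OF ZP] .
      also have "\<dots> \<le> K * (\<bar>D\<bar> + 1)" using that(2) K(1) by (intro mult_left_mono) auto
      finally show ?thesis
        using that h dist_triangle[of "P v" u v] by (auto simp: closest_proj_def)
    qed
    have cl: "dist (P v) u \<le> 3 * (\<delta> * h)" if "u \<in> closest_proj Z v" "infdist v Z \<le> 2 * h" for u v
    proof (cases "D \<le> infdist v Z")
      case True
      have "\<delta> * infdist v Z \<le> \<delta> * (2 * h)" using that \<delta> by simp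
      then show ?thesis using far[OF that(1) True] by linarith
    next
      case False
      then show ?thesis using near[OF that(1)] \<delta> h(4) mult_nonneg_nonneg[of \<delta> h] by linarith
    qed
    have Pxy: "dist (P x) (P y) \<le> \<delta> * h"
      using D[OF ZP, of x y] h by (simp add: h_def)
    have "dist (P x) u \<le> 4 * (\<delta> * h)" if "u \<in> closest_proj Z x \<union> closest_proj Z y" for u
    proof -
      have "0 \<le> \<delta> * h" using \<delta> h by simp
      moreover have "dist (P x) u \<le> 3 * (\<delta> * h) \<or> dist (P y) u \<le> 3 * (\<delta> * h)"
        using that cl[of u x] cl[of u y] hy h(4) by (auto simp: h_def)
      ultimately show ?thesis using Pxy dist_triangle[of "P x" u "P y"] by linarith
    qed
    from this[OF z] this[OF w] show ?thesis
      using dist_triangle3[of z w "P x"] by (simp add: \<delta>_def h_def)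
  qed
  then show ?thesis by blast
qed

lemma coarse_contraction_imp_sublinear:
  fixes F :: "('a::proper_geodesic_space set \<times> ('a \<Rightarrow> 'a)) set"
  assumes F: "coarse_contraction F" "F \<noteq> {}"
    and cl: "\<And>Z P. (Z, P) \<in> F \<Longrightarrow> closed Z" "\<And>Z P. (Z, P) \<in> F \<Longrightarrow> Z \<noteq> {}"
  shows "sublinear (sup_diam (fst ` F))" "\<And>Z P. (Z, P) \<in> F \<Longrightarrow> rho_contracting (sup_diam (fst ` F)) Z"
proof -
  have small: "\<exists>D. \<forall>Z\<in>fst ` F. \<forall>x y z w. D \<le> infdist x Z \<longrightarrow> dist x y \<le> infdist x Z \<longrightarrow>
      z \<in> closest_proj Z x \<union> closest_proj Z y \<longrightarrow> w \<in> closest_proj Z x \<union> closest_proj Z y \<longrightarrow>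
      dist z w \<le> \<epsilon> * infdist x Z" if "\<epsilon> > 0" for \<epsilon>
    using coarse_contraction_closest_proj[OF F(1) that] by (metis (no_types) imageE prod.collapse)
  note * = sublinear_sup_diam[of "fst ` F", OF _ _ _ small]
  show "sublinear (sup_diam (fst ` F))"
    using * F(2) cl by (force intro!: *(1))
  show "rho_contracting (sup_diam (fst ` F)) Z" if "(Z, P) \<in> F" for Z P
    using F(2) cl that by (force intro!: *(2))
qed

text \<open>The projection is kept and only the set changes. Heights shift by at most
  \<open>H\<close>, which is absorbed by a larger linear constant, by halving the admissible
  displacement, and by raising the threshold so that heights over the two sets differ by at most a
  factor 2.\<close>

lemma coarse_contraction_close:
  assumes F: "coarse_contraction F"
    and close: "\<And>Z' P. (Z', P) \<in> F' \<Longrightarrow> \<exists>Z. (Z, P) \<in> F \<and> (\<forall>x. \<bar>infdist x Z - infdist x Z'\<bar> \<le> H)"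
  shows "coarse_contraction F'"
proof -
  obtain K1 where K1: "K1 \<ge> 1" "\<And>Z P x. (Z, P) \<in> F \<Longrightarrow> dist (P x) x \<le> K1 * (infdist x Z + 1)"
    using F unfolding coarse_contraction_def by metis
  obtain K2 where K2: "K2 \<ge> 1" "\<And>\<epsilon>. \<epsilon> > 0 \<Longrightarrow> \<exists>R. \<forall>Z P x y. (Z, P) \<in> F \<longrightarrow> R \<le> infdist x Z \<longrightarrow>
     K2 * dist x y \<le> infdist x Z \<longrightarrow> dist (P x) (P y) \<le> \<epsilon> * infdist x Z"
    using F unfolding coarse_contraction_def by metis
  \<comment> \<open>When \<open>F'\<close> is empty, nothing forces \<open>H\<close> to be
    nonnegative.\<close>
  define H' where "H' = \<bar>H\<bar>"
  have H: "H' \<ge> 0" "H \<le> H'" by (auto simp: H'_def)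
  show ?thesis
  proof (rule coarse_contractionI[of "K1 * (H' + 1)" _ "2 * K2"])
    show "1 \<le> K1 * (H' + 1)" using mult_mono[of 1 K1 1 "H' + 1"] K1 H by simp
    show "1 \<le> 2 * K2" using K2(1) by simp
  next
    fix Z' P x assume "(Z', P) \<in> F'"
    then obtain Z where Z: "(Z, P) \<in> F" "\<And>x. \<bar>infdist x Z - infdist x Z'\<bar> \<le> H" using close by blast
    have "dist (P x) x \<le> K1 * (infdist x Z + 1)" using K1(2) Z by blast
    also have "\<dots> \<le> K1 * ((H' + 1) * (infdist x Z' + 1))"
      using Z(2)[of x] H K1(1) mult_nonneg_nonneg[OF H(1) infdist_nonneg[of x Z']]
      by (intro mult_left_mono) (auto simp: algebra_simps)
    finally show "dist (P x) x \<le> K1 * (H' + 1) * (infdist x Z' + 1)" by (simp add: mult.assoc)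
  next
    fix \<epsilon> :: real assume \<epsilon>: "\<epsilon> > 0"
    obtain R where R: "\<And>Z P x y. (Z, P) \<in> F \<Longrightarrow> R \<le> infdist x Z \<Longrightarrow>
       K2 * dist x y \<le> infdist x Z \<Longrightarrow> dist (P x) (P y) \<le> \<epsilon> / 2 * infdist x Z"
      using K2(2)[of "\<epsilon> / 2"] \<epsilon> by (metis half_gt_zero)
    have "dist (P x) (P y) \<le> \<epsilon> * infdist x Z'"
      if "(Z', P) \<in> F'" "max (R + H') (2 * H') \<le> infdist x Z'" "2 * K2 * dist x y \<le> infdist x Z'" for Z' P x y
    proof -
      obtain Z where Z: "(Z, P) \<in> F" "\<And>x. \<bar>infdist x Z - infdist x Z'\<bar> \<le> H" using close \<open>(Z', P) \<in> F'\<close> by blast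
      have *: "R \<le> infdist x Z" "K2 * dist x y \<le> infdist x Z" "infdist x Z \<le> 2 * infdist x Z'"
        using Z(2)[of x] H that(2,3) by linarith+
      have "dist (P x) (P y) \<le> \<epsilon> / 2 * infdist x Z" by (rule R[OF Z(1) *(1,2)])
      also have "\<dots> \<le> \<epsilon> * infdist x Z'" using *(3) \<epsilon> by simp
      finally show ?thesis .
    qed
    then show "\<exists>R. \<forall>Z P x y. (Z, P) \<in> F' \<longrightarrow> R \<le> infdist x Z \<longrightarrow> 2 * K2 * dist x y \<le> infdist x Z \<longrightarrow>
       dist (P x) (P y) \<le> \<epsilon> * infdist x Z" by blast
  qed
qed

lemma rho_contracting_imp_coarse_contraction:
  assumes "sublinear \<rho>" "rho_contracting \<rho> Z" and P: "\<And>x. P x \<in> closest_proj Z x"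
  shows "coarse_contraction {(Z, P)}"
proof (rule coarse_contractionI[of 1 _ 1])
  fix \<epsilon> :: real assume "\<epsilon> > 0"
  then obtain D where D: "\<And>r. r \<ge> D \<Longrightarrow> \<rho> r \<le> \<epsilon> * r"
    using sublinear_eventually_le[OF assms(1)] by blast
  have "dist (P x) (P y) \<le> \<epsilon> * infdist x Z" if "D \<le> infdist x Z" "dist x y \<le> infdist x Z" for x y
    using rho_contractingD[OF assms(2) that(2), of "P x" "P y"] D[OF that(1)] P[of x] P[of y] by force
  then show "\<exists>R. \<forall>Z' P' x y. (Z', P') \<in> {(Z, P)} \<longrightarrow> R \<le> infdist x Z' \<longrightarrow> 1 * dist x y \<le> infdist x Z' \<longrightarrow>
       dist (P' x) (P' y) \<le> \<epsilon> * infdist x Z'" by auto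
qed (use P in \<open>auto simp: closest_proj_def dist_commute\<close>)

text \<open>Heights above a set and above its closure agree, so the projection to the closure serves
  for \<open>Z\<close> itself. Together with \<open>coarse_contraction_imp_contracting\<close> this
  translates between contracting sets and coarse projections.\<close>

lemma contracting_obtain_projection:
  fixes Z :: "'a::proper_geodesic_space set"
  assumes "contracting Z" "Z \<noteq> {}"
  obtains P where "coarse_contraction {(Z, P)}" "\<And>x. P x \<in> closest_proj (closure Z) x"
proof -
  obtain \<rho> where \<rho>: "sublinear \<rho>" "rho_contracting \<rho> (closure Z)"
    using assms(1) unfolding contracting_def by blast
  define P where "P x = (SOME z. z \<in> closest_proj (closure Z) x)" for x
  have P: "P x \<in> closest_proj (closure Z) x" for x
    unfolding P_def using closest_proj_nonempty[of "closure Z" x] assms(2) by (auto intro: someI)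
  have "coarse_contraction {(closure Z, P)}"
    by (rule rho_contracting_imp_coarse_contraction[OF \<rho> P])
  then have "coarse_contraction {(Z, P)}"
    by (rule coarse_contraction_close[of _ _ 0]) auto
  then show thesis using P that by blast
qed

lemma coarse_contraction_imp_contracting:
  fixes Z :: "'a::proper_geodesic_space set"
  assumes "coarse_contraction {(Z, P)}" "Z \<noteq> {}"
  shows "contracting Z"
proof -
  have c: "coarse_contraction {(closure Z, P)}"
    by (rule coarse_contraction_close[OF assms(1), of _ 0]) auto
  have "sublinear (sup_diam (fst ` {(closure Z, P)}))"
      "rho_contracting (sup_diam (fst ` {(closure Z, P)})) (closure Z)"
    using coarse_contraction_imp_sublinear[OF c] assms(2) by auto
  then show ?thesis unfolding contracting_def by blast
qed

lemma infdist_le_of_close: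
  assumes "\<And>s. s \<in> S \<Longrightarrow> \<exists>t\<in>T. dist s t \<le> C" "S \<noteq> {}"
  shows "infdist x T \<le> infdist x S + C"
proof (rule field_le_epsilon)
  fix e :: real assume "e > 0"
  then obtain s where s: "s \<in> S" "dist x s < infdist x S + e"
    using infdist_less_obtain[of x S "infdist x S + e"] assms(2) by auto
  obtain t where "t \<in> T" "dist s t \<le> C" using assms(1)[OF s(1)] by blast
  then show "infdist x T \<le> infdist x S + C + e"
    using infdist_le[of t T x] dist_triangle[of x t s] s by linarith
qed

lemma finite_hausdorff_distance_infdist:
  assumes "finite_hausdorff_distance S T" "S \<noteq> {}" "T \<noteq> {}"
  shows "\<exists>H. \<forall>x. \<bar>infdist x S - infdist x T\<bar> \<le> H"
proof -
  obtain C where C: "\<forall>s\<in>S. \<exists>t\<in>T. dist s t \<le> C" "\<forall>t\<in>T. \<exists>s\<in>S. dist t s \<le> C"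
    using assms(1) unfolding finite_hausdorff_distance_def by (metis dist_commute)
  have "\<bar>infdist x S - infdist x T\<bar> \<le> C" for x
    using infdist_le_of_close[of S T C x] infdist_le_of_close[of T S C x] C assms(2,3) by fastforce
  then show ?thesis by blast
qed

lemma contracting_finite_hausdorff_distance:
  fixes S T :: "'a::proper_geodesic_space set"
  assumes "contracting S" "finite_hausdorff_distance S T" "S \<noteq> {}" "T \<noteq> {}"
  shows "contracting T"
proof -
  obtain P where P: "coarse_contraction {(S, P)}"
    using contracting_obtain_projection assms(1,3) by blast
  obtain H where "\<And>x. \<bar>infdist x S - infdist x T\<bar> \<le> H"
    using finite_hausdorff_distance_infdist[OF assms(2-4)] by blast
  then have "coarse_contraction {(T, P)}"
    by (intro coarse_contraction_close[OF P, of _ H]) auto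
  then show ?thesis using assms(4) coarse_contraction_imp_contracting by blast
qed

section \<open>Contracting sets and quasi-isometric embeddings\<close>

text \<open>The lower bound is multiplied out, which keeps divisions by \<open>L\<close> out of most
  later estimates.\<close>

lemma LA_qi_embedding_onD:
  assumes "LA_qi_embedding_on L A S f"
  shows "L \<ge> 1" "A \<ge> 0" "\<And>x y. x \<in> S \<Longrightarrow> y \<in> S \<Longrightarrow> dist (f x) (f y) \<le> L * dist x y + A"
    "\<And>x y. x \<in> S \<Longrightarrow> y \<in> S \<Longrightarrow> dist x y \<le> L * (dist (f x) (f y) + A)"
proof -
  show L: "L \<ge> 1" "A \<ge> 0" "\<And>x y. x \<in> S \<Longrightarrow> y \<in> S \<Longrightarrow> dist (f x) (f y) \<le> L * dist x y + A"
    using assms by (auto simp: LA_qi_embedding_on_def)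
  show "dist x y \<le> L * (dist (f x) (f y) + A)" if "x \<in> S" "y \<in> S" for x y
  proof -
    have "dist x y / L \<le> dist (f x) (f y) + A"
      using assms that by (fastforce simp: LA_qi_embedding_on_def)
    then show ?thesis using L(1) by (simp add: field_simps)
  qed
qed

lemma LA_qi_embedding_onI:
  assumes "L \<ge> 1" "A \<ge> 0" "\<And>x y. x \<in> S \<Longrightarrow> y \<in> S \<Longrightarrow> dist (f x) (f y) \<le> L * dist x y + A"
    "\<And>x y. x \<in> S \<Longrightarrow> y \<in> S \<Longrightarrow> dist x y \<le> L * (dist (f x) (f y) + A)"
  shows "LA_qi_embedding_on L A S f"
proof -
  have "1 / L * dist x y - A \<le> dist (f x) (f y)" if "x \<in> S" "y \<in> S" for x y
    using assms(4)[OF that] assms(1) by (simp add: field_simps)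
  then show ?thesis using assms by (auto simp: LA_qi_embedding_on_def)
qed

lemma infdist_qi_image_le:
  assumes "LA_qi_embedding_on L A UNIV f" "Z \<noteq> {}"
  shows "infdist (f x) (f ` Z) \<le> L * infdist x Z + A" "infdist x Z \<le> L * (infdist (f x) (f ` Z) + A)"
proof -
  note f = LA_qi_embedding_onD[OF assms(1)]
  show "infdist (f x) (f ` Z) \<le> L * infdist x Z + A"
  proof (rule field_le_epsilon)
    fix e :: real assume "e > 0"
    then have "infdist x Z < infdist x Z + e / L" using f(1) by simp
    then obtain z where z: "z \<in> Z" "dist x z < infdist x Z + e / L"
      using infdist_less_obtain assms(2) by blast
    have "L * dist x z \<le> L * (infdist x Z + e / L)" using z(2) f(1) by simp
    also have "\<dots> = L * infdist x Z + e" using f(1) by (simp add: field_simps)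
    finally show "infdist (f x) (f ` Z) \<le> L * infdist x Z + A + e"
      using f(3)[of x z] infdist_le[of "f z" "f ` Z" "f x"] z(1) by simp
  qed
  show "infdist x Z \<le> L * (infdist (f x) (f ` Z) + A)"
  proof (rule field_le_epsilon)
    fix e :: real assume "e > 0"
    then have "infdist (f x) (f ` Z) < infdist (f x) (f ` Z) + e / L" using f(1) by simp
    then obtain z where z: "z \<in> Z" "dist (f x) (f z) < infdist (f x) (f ` Z) + e / L"
      using infdist_less_obtain[of "f x" "f ` Z"] assms(2) by blast
    have "L * (dist (f x) (f z) + A) \<le> L * (infdist (f x) (f ` Z) + e / L + A)" using z(2) f(1) by simp
    also have "\<dots> = L * (infdist (f x) (f ` Z) + A) + e" using f(1) by (simp add: field_simps)
    finally show "infdist x Z \<le> L * (infdist (f x) (f ` Z) + A) + e"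
      using f(4)[of x z] infdist_le[OF z(1), of x] by simp
  qed
qed

lemma contracting_qi_preimage:
  fixes f :: "'a::proper_geodesic_space \<Rightarrow> 'b::proper_geodesic_space"
  assumes f: "LA_qi_embedding_on L A UNIV f" and Z: "contracting (f ` Z)" "Z \<noteq> {}"
  shows "contracting Z"
proof -
  note fD = LA_qi_embedding_onD[OF f]
  note inf = infdist_qi_image_le[OF f Z(2)]
  obtain Q where Q: "coarse_contraction {(f ` Z, Q)}" "\<And>x. Q x \<in> closest_proj (closure (f ` Z)) x"
    using contracting_obtain_projection[OF Z(1)] Z(2) by blast
  have "\<exists>z\<in>Z. dist (f z) (Q y) < 1" for y
    using Q(2)[of y] closure_approachable[of "Q y" "f ` Z"] by (auto simp: closest_proj_def)
  then obtain g where g: "\<And>y. g y \<in> Z" "\<And>y. dist (f (g y)) (Q y) < 1" by metis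
  define P where "P x = g (f x)" for x
  have Qd: "dist (Q y) y = infdist y (f ` Z)" for y
    using Q(2)[of y] by (simp add: closest_proj_def dist_commute)
  have PP: "dist (P x) (P y) \<le> L * (dist (Q (f x)) (Q (f y)) + 2 + A)" for x y
  proof -
    have "dist (f (P x)) (f (P y)) \<le> dist (Q (f x)) (Q (f y)) + 2"
      using g(2)[of "f x"] g(2)[of "f y"] dist_triangle[of "f (P x)" "f (P y)" "Q (f x)"]
        dist_triangle2[of "Q (f x)" "f (P y)" "Q (f y)"] by (simp add: P_def dist_commute)
    then have "L * (dist (f (P x)) (f (P y)) + A) \<le> L * (dist (Q (f x)) (Q (f y)) + 2 + A)"
      using fD(1) by simp
    then show ?thesis using fD(4)[of "P x" "P y"] by simp
  qed
  have "coarse_contraction {(Z, P)}"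
  \<comment> \<open>A displacement of at most \<open>h / (2 * L\<^sup>2)\<close> becomes at most
    \<open>h / (2 * L) + A\<close> after applying \<open>f\<close>. This stays below the image
    height, which is at least \<open>h / L - A\<close>, once \<open>h\<close> is at least
    \<open>4 * L * A\<close>.\<close>
  proof (rule coarse_contractionI[of "L * (L + 1 + 2 * A)" _ "2 * L\<^sup>2"])
    show "1 \<le> L * (L + 1 + 2 * A)" using mult_mono[of 1 L 1 "L + 1 + 2 * A"] fD(1,2) by simp
    show "1 \<le> 2 * L\<^sup>2" using fD(1) one_le_power[of L 2] by linarith
  next
    fix Z' P' x assume "(Z', P') \<in> {(Z, P)}"
    then have [simp]: "Z' = Z" "P' = P" by auto
    have "dist (f (P x)) (f x) \<le> 1 + infdist (f x) (f ` Z)"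
      using g(2)[of "f x"] Qd[of "f x"] dist_triangle[of "f (P x)" "f x" "Q (f x)"] by (simp add: P_def)
    then have "dist (f (P x)) (f x) + A \<le> L * infdist x Z + 1 + 2 * A" using inf(1)[of x] by linarith
    also have "\<dots> \<le> (L + 1 + 2 * A) * (infdist x Z + 1)"
      using fD(1,2) mult_nonneg_nonneg[OF _ infdist_nonneg[of x Z], of "1 + 2 * A"] by (simp add: algebra_simps)
    finally have "L * (dist (f (P x)) (f x) + A) \<le> L * ((L + 1 + 2 * A) * (infdist x Z + 1))"
      using fD(1) by simp
    then show "dist (P' x) x \<le> L * (L + 1 + 2 * A) * (infdist x Z' + 1)"
      using fD(4)[of "P x" x] by (simp add: mult.assoc)
  next
    fix \<epsilon> :: real assume \<epsilon>: "\<epsilon> > 0"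
    define \<delta> where "\<delta> = \<epsilon> / (4 * L\<^sup>2)"
    have L2: "L\<^sup>2 > 0" using fD(1) by simp
    then have \<delta>: "\<delta> > 0" using \<epsilon> by (simp add: \<delta>_def)
    obtain R where R: "\<And>x y. R \<le> infdist x (f ` Z) \<Longrightarrow> dist x y \<le> infdist x (f ` Z) \<Longrightarrow>
        dist (Q x) (Q y) \<le> \<delta> * infdist x (f ` Z)"
      using coarse_contraction_unit_scale[OF Q(1) \<delta>] by auto
    \<comment> \<open>The entries ensure, in this order, that the image displacement is at most the
      image height, that the image height reaches \<open>R\<close>, and that the additive error
      \<open>L * (2 + A)\<close> is at most \<open>\<epsilon> * h / 2\<close>.\<close>
    define D where "D = max (max (4 * L * A) (L * (\<bar>R\<bar> + A))) (2 * L * (2 + A) / \<epsilon>)"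
    have "dist (P x) (P y) \<le> \<epsilon> * infdist x Z"
      if x: "D \<le> infdist x Z" and y: "2 * L\<^sup>2 * dist x y \<le> infdist x Z" for x y
    proof -
      define h where "h = infdist x Z"
      define h' where "h' = infdist (f x) (f ` Z)"
      have h: "4 * L * A \<le> h" "L * (\<bar>R\<bar> + A) \<le> h" "2 * L * (2 + A) \<le> \<epsilon> * h" "0 \<le> h"
        using x \<epsilon> by (auto simp: D_def h_def field_simps infdist_nonneg)
      have hh': "h' \<le> L * h + A" "h \<le> L * (h' + A)" using inf[of x] by (auto simp: h_def h'_def)
      have "L * (\<bar>R\<bar> + A) \<le> L * (h' + A)" using h hh' by linarith
      then have Rh: "R \<le> h'" using fD(1) by simp
      have "L * (L * dist x y + A) \<le> L * h'"
        using y hh'(2) h(1) by (simp add: h_def power2_eq_square algebra_simps)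
      then have "dist (f x) (f y) \<le> h'" using fD(1) fD(3)[of x y] by simp
      then have "dist (Q (f x)) (Q (f y)) \<le> \<delta> * h'" using R[of "f x" "f y"] Rh by (simp add: h'_def)
      also have "\<dots> \<le> \<delta> * (2 * L * h)"
      proof -
        have "A \<le> L * A" using fD(1,2) mult_right_mono[of 1 L A] by simp
        moreover have "h \<le> L * h" using fD(1) h(4) mult_right_mono[of 1 L h] by simp
        ultimately show ?thesis using \<delta> hh'(1) h(1) fD(2) by (intro mult_left_mono) linarith+
      qed
      finally have "L * (dist (Q (f x)) (Q (f y)) + 2 + A) \<le> L * (\<delta> * (2 * L * h) + 2 + A)"
        using fD(1) by simp
      also have "\<dots> = \<epsilon> * h / 2 + L * (2 + A)"
        using fD(1) by (simp add: \<delta>_def field_simps power2_eq_square)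
      finally show ?thesis using PP[of x y] h(3) by (simp add: h_def)
    qed
    then show "\<exists>R. \<forall>Z' P' x y. (Z', P') \<in> {(Z, P)} \<longrightarrow> R \<le> infdist x Z' \<longrightarrow>
       2 * L\<^sup>2 * dist x y \<le> infdist x Z' \<longrightarrow> dist (P' x) (P' y) \<le> \<epsilon> * infdist x Z'" by auto
  qed
  then show ?thesis using Z(2) by (rule coarse_contraction_imp_contracting)
qed

text \<open>The coarse projection to \<open>f ` Z\<close> goes through the closest-point projections to the range
  of \<open>f\<close> and then, inside the domain, to \<open>Z\<close>. Far from the range the former contracts
  and close to the range the latter does.\<close>

lemma contracting_qi_image:
  fixes f :: "'a::proper_geodesic_space \<Rightarrow> 'b::proper_geodesic_space"
  assumes f: "LA_qi_embedding_on L A UNIV f" and Y: "contracting (range f)"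
    and Z: "contracting Z" "Z \<noteq> {}"
  shows "contracting (f ` Z)"
proof -
  note fD = LA_qi_embedding_onD[OF f]
  note inf = infdist_qi_image_le[OF f Z(2)]
  obtain Q where Q: "coarse_contraction {(range f, Q)}" "\<And>x. Q x \<in> closest_proj (closure (range f)) x"
    using contracting_obtain_projection[OF Y] by blast
  obtain P where P: "coarse_contraction {(Z, P)}" "\<And>x. P x \<in> closest_proj (closure Z) x"
    using contracting_obtain_projection[OF Z] by blast
  have "\<exists>x. dist (f x) (Q y) < 1" for y
    using Q(2)[of y] closure_approachable[of "Q y" "range f"] by (auto simp: closest_proj_def)
  then obtain a where a: "\<And>y. dist (f (a y)) (Q y) < 1" by metis
  have Qd: "dist (Q y) y = infdist y (range f)" for y
    using Q(2)[of y] by (simp add: closest_proj_def dist_commute)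
  have Pd: "dist (P y) y = infdist y Z" for y
    using P(2)[of y] by (simp add: closest_proj_def dist_commute)
  have Yle: "infdist y (range f) \<le> infdist y (f ` Z)" for y
    using Z(2) by (intro infdist_mono) auto
  have fa: "dist (f (a y)) y \<le> 1 + infdist y (range f)" for y
    using a[of y] Qd[of y] dist_triangle[of "f (a y)" y "Q y"] by simp
  have ha: "infdist (a y) Z \<le> L * (2 * infdist y (f ` Z) + 1 + A)" for y
  proof -
    have "infdist (f (a y)) (f ` Z) \<le> 2 * infdist y (f ` Z) + 1"
      using infdist_triangle'[of "f (a y)" "f ` Z" y] fa[of y] Yle[of y] by (simp add: dist_commute)
    then have "L * (infdist (f (a y)) (f ` Z) + A) \<le> L * (2 * infdist y (f ` Z) + 1 + A)"
      using fD(1) by simp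
    then show ?thesis using inf(2)[of "a y"] by simp
  qed
  have aa: "dist (a x) (a y) \<le> L * (dist (Q x) (Q y) + 2 + A)" for x y
  proof -
    have "dist (f (a x)) (f (a y)) \<le> dist (Q x) (Q y) + 2"
      using a[of x] a[of y] dist_triangle[of "f (a x)" "f (a y)" "Q x"]
        dist_triangle2[of "Q x" "f (a y)" "Q y"] by (simp add: dist_commute)
    then have "L * (dist (f (a x)) (f (a y)) + A) \<le> L * (dist (Q x) (Q y) + 2 + A)"
      using fD(1) by simp
    then show ?thesis using fD(4)[of "a x" "a y"] by simp
  qed
  have L2: "L\<^sup>2 \<ge> 1" "L\<^sup>2 > 0" "L \<noteq> 0" using fD(1) one_le_power[of L 2] by auto
  define P' where "P' y = f (P (a y))" for y
  \<comment> \<open>With \<open>d = h / K\<close>, the displacement bound of \<open>a\<close>,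
    multiplied by \<open>L\<close>, has leading term \<open>4 * L\<^sup>2 * d = 2/5 * h\<close>, and
    the loss \<open>d\<close> in height is at most \<open>h / 10\<close>. The remaining
    \<open>h / 2\<close> pays for the additive constants, which makes the case near the range
    work.\<close>
  define K where "K = 10 * L\<^sup>2"
  have K: "K \<ge> 10" "K > 0" using L2 by (auto simp: K_def)
  have "coarse_contraction {(f ` Z, P')}"
  proof (rule coarse_contractionI[of "2 * L\<^sup>2 * (1 + A) + A + 2" _ K])
    show "1 \<le> 2 * L\<^sup>2 * (1 + A) + A + 2" using L2 fD(2) mult_nonneg_nonneg[of "2 * L\<^sup>2" "1 + A"] by linarith
    show "1 \<le> K" using K by simp
  next
    fix Z' Q' y assume "(Z', Q') \<in> {(f ` Z, P')}"
    then have [simp]: "Z' = f ` Z" "Q' = P'" by auto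
    define h where "h = infdist y (f ` Z)"
    have h: "h \<ge> 0" by (simp add: h_def infdist_nonneg)
    have "dist (f (P (a y))) (f (a y)) \<le> L * infdist (a y) Z + A" using fD(3)[of "P (a y)" "a y"] Pd by simp
    also have "\<dots> \<le> L * (L * (2 * h + 1 + A)) + A" using ha[of y] fD(1) by (simp add: h_def)
    finally have "dist (P' y) y \<le> L\<^sup>2 * (2 * h + 1 + A) + A + 1 + h"
      using fa[of y] Yle[of y] dist_triangle[of "P' y" y "f (a y)"]
      by (simp add: P'_def h_def power2_eq_square algebra_simps)
    also have "L\<^sup>2 * (2 * h + 1 + A) \<le> L\<^sup>2 * (2 * (1 + A) * (h + 1))"
      using fD(2) h L2(1) by (intro mult_left_mono) (auto simp: algebra_simps)
    also have "L\<^sup>2 * (2 * (1 + A) * (h + 1)) + A + 1 + h \<le> (2 * L\<^sup>2 * (1 + A) + A + 2) * (h + 1)"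
      using fD(2) h by (simp add: algebra_simps)
    finally show "dist (Q' y) y \<le> (2 * L\<^sup>2 * (1 + A) + A + 2) * (infdist y Z' + 1)" by (simp add: h_def)
  next
    fix \<epsilon> :: real assume \<epsilon>: "\<epsilon> > 0"
    \<comment> \<open>Chosen so that four times \<open>m = 2 * L * \<delta> * h\<close> is
      \<open>\<epsilon> * h / (2 * L)\<close>. Applying \<open>f\<close> then costs a factor
      \<open>L\<close> and an additive \<open>A\<close>, which gives the required
      \<open>\<epsilon> * h\<close>.\<close>
    define \<delta> where "\<delta> = \<epsilon> / (16 * L\<^sup>2)"
    have \<delta>: "\<delta> > 0" "16 * L\<^sup>2 * \<delta> = \<epsilon>" using \<epsilon> L2 by (auto simp: \<delta>_def)
    obtain RY where RY: "\<And>x y. RY \<le> infdist x (range f) \<Longrightarrow> dist x y \<le> infdist x (range f) \<Longrightarrow>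
        dist (Q x) (Q y) \<le> \<delta> * infdist x (range f)"
      using coarse_contraction_unit_scale[OF Q(1) \<delta>(1)] by auto
    define \<theta> where "\<theta> = \<epsilon> / (8 * L\<^sup>2)"
    have \<theta>: "\<theta> > 0" using \<epsilon> L2 by (auto simp: \<theta>_def)
    obtain RZ where RZ: "\<And>x y. RZ \<le> infdist x Z \<Longrightarrow> dist x y \<le> infdist x Z \<Longrightarrow>
        dist (P x) (P y) \<le> \<theta> * infdist x Z"
      using coarse_contraction_unit_scale[OF P(1) \<theta>] by auto
    show "\<exists>R. \<forall>Z' Q' x y. (Z', Q') \<in> {(f ` Z, P')} \<longrightarrow> R \<le> infdist x Z' \<longrightarrow>
       K * dist x y \<le> infdist x Z' \<longrightarrow> dist (Q' x) (Q' y) \<le> \<epsilon> * infdist x Z'"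
    proof -
      \<comment> \<open>Lower bounds on the height \<open>h\<close>.
        \<open>2 * A / \<epsilon>\<close> absorbs the additive error of \<open>f\<close> in the last
        step, \<open>1 + A\<close> and \<open>(2 + A) / \<delta>\<close> those of \<open>ha\<close>
        and \<open>aa\<close>. \<open>K * RY\<close> and \<open>RZ / (2 * L * \<delta>)\<close>
        bring the height over the range and the scale \<open>m\<close> above the thresholds of
        \<open>Q\<close> and \<open>P\<close>. The last two entries make \<open>a x\<close> high
        above \<open>Z\<close> when x is near the range.\<close>
      define S where "S = {2 * A / \<epsilon>, 1 + A, K * RY, (2 + A) / \<delta>, RZ / (2 * L * \<delta>),
        2 * (L\<^sup>2 * (2 + A) + 1 + A), 4 * (L * \<bar>RZ\<bar>)}"
      have "dist (P' x) (P' y) \<le> \<epsilon> * infdist x (f ` Z)"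
        if x: "Max S \<le> infdist x (f ` Z)" and y: "K * dist x y \<le> infdist x (f ` Z)" for x y
      proof -
        define h where "h = infdist x (f ` Z)"
        define m where "m = 2 * L * \<delta> * h"
        have "finite S" by (simp add: S_def)
        then have S: "d \<le> h" if "d \<in> S" for d using that x unfolding h_def by (meson Max_ge order_trans)
        have "2 * A / \<epsilon> \<le> h" "1 + A \<le> h" "K * RY \<le> h" "(2 + A) / \<delta> \<le> h" "RZ / (2 * L * \<delta>) \<le> h"
          and h2: "2 * (L\<^sup>2 * (2 + A) + 1 + A) \<le> h" "4 * (L * \<bar>RZ\<bar>) \<le> h"
          by (rule S, simp add: S_def)+
        then have h1: "2 * A \<le> \<epsilon> * h" "1 + A \<le> h" "K * RY \<le> h" "2 + A \<le> \<delta> * h" "RZ \<le> m"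
          using \<epsilon> \<delta>(1) fD(1) by (simp_all add: field_simps m_def)
        have hax: "infdist (a x) Z \<le> L * (3 * h)"
        proof -
          have "L * (2 * h + 1 + A) \<le> L * (3 * h)" using h1(2) fD(1) by simp
          then show ?thesis using ha[of x] unfolding h_def by linarith
        qed
        have PZ: "dist (P (a x)) (P (a y)) \<le> \<epsilon> * h / (2 * L)"
          if "RZ \<le> infdist (a x) Z" "dist (a x) (a y) \<le> infdist (a x) Z"
        proof -
          have "dist (P (a x)) (P (a y)) \<le> \<theta> * (L * (3 * h))"
            using RZ[OF that] hax \<theta> by (meson mult_left_mono less_imp_le order_trans)
          also have "\<dots> = 3 / 8 * (\<epsilon> * h / L)"
            using fD(1) by (simp add: \<theta>_def power2_eq_square)
          also have "\<dots> \<le> \<epsilon> * h / (2 * L)" using \<epsilon> h1(2) fD(1,2) by (simp add: field_simps)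
          finally show ?thesis .
        qed
        have "dist (P (a x)) (P (a y)) \<le> \<epsilon> * h / (2 * L)"
        \<comment> \<open>Far from the range, \<open>Q\<close> contracts and \<open>a x\<close>,
          \<open>a y\<close> are within \<open>m\<close> of each other: then either
          \<open>a x\<close> is at least \<open>m\<close> above \<open>Z\<close> and
          \<open>P\<close> contracts, or both points are so low that \<open>P\<close> moves them
          little. Near the range, \<open>f (a x)\<close> is close to x, so \<open>a x\<close>
          inherits a height of order \<open>h / L\<close> and \<open>P\<close> contracts
          again.\<close>
        proof (cases "h \<le> K * infdist x (range f)")
          case True
          have "K * RY \<le> K * infdist x (range f)" "K * dist x y \<le> K * infdist x (range f)"
            using True h1(3) y by (simp_all add: h_def)
          then have "dist (Q x) (Q y) \<le> \<delta> * infdist x (range f)" using RY K(2) by simp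
          also have "\<dots> \<le> \<delta> * h" using Yle[of x] \<delta> by (simp add: h_def)
          finally have "L * (dist (Q x) (Q y) + 2 + A) \<le> L * (2 * (\<delta> * h))"
            using h1(4) fD(1) by (intro mult_left_mono) linarith+
          then have aam: "dist (a x) (a y) \<le> m" using aa[of x y] by (simp add: m_def)
          show ?thesis
          proof (cases "m \<le> infdist (a x) Z")
            case True
            then show ?thesis using PZ h1(5) aam by linarith
          next
            case False
            have "infdist (a y) Z \<le> 2 * m"
              using False aam infdist_triangle'[of "a y" Z "a x"] by linarith
            then have "dist (P (a x)) (P (a y)) \<le> 4 * m"
              using False aam Pd[of "a x"] Pd[of "a y"] dist_triangle[of "P (a x)" "P (a y)" "a x"]
                dist_triangle2[of "a x" "P (a y)" "a y"] by (simp add: dist_commute)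
            also have "4 * m = \<epsilon> * h / (2 * L)"
              using fD(1) by (simp add: m_def \<delta>_def power2_eq_square)
            finally show ?thesis .
          qed
        next
          case False
          define d where "d = h / K"
          have Kd: "K * d = h" "10 * d \<le> h" "4 * (L\<^sup>2 * d) = 2 / 5 * h"
          proof -
            show *: "K * d = h" using K(2) by (simp add: d_def)
            have "d \<ge> 0" using h1(2) fD(2) K(2) by (simp add: d_def)
            then show "10 * d \<le> h" using mult_right_mono[OF K(1), of d] * by simp
            show "4 * (L\<^sup>2 * d) = 2 / 5 * h" using * by (simp add: K_def ac_simps)
          qed
          have dd: "infdist x (range f) \<le> d" "dist x y \<le> d"
          proof -
            have "K * infdist x (range f) \<le> K * d" "K * dist x y \<le> K * d"
              using False y Kd(1) by (simp_all add: h_def)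
            then show "infdist x (range f) \<le> d" "dist x y \<le> d" using K(2) by simp_all
          qed
          have hYy: "infdist y (range f) \<le> 2 * d"
            using dd infdist_triangle'[of y "range f" x] by linarith
          have "dist (Q x) (Q y) \<le> 4 * d"
            using dd hYy Qd[of x] Qd[of y] dist_triangle[of "Q x" "Q y" x] dist_triangle2[of x "Q y" y]
            by (simp add: dist_commute)
          then have "L * (dist (Q x) (Q y) + 2 + A) \<le> L * (4 * d + 2 + A)" using fD(1) by simp
          then have 1: "dist (a x) (a y) \<le> L * (4 * d + 2 + A)" using aa[of x y] by simp
          have low: "h - 1 - d - A \<le> L * infdist (a x) Z"
            using inf(1)[of "a x"] fa[of x] dd(1) infdist_triangle[of x "f ` Z" "f (a x)"]
            by (simp add: h_def dist_commute)
          have "L * (L * (4 * d + 2 + A)) = 2 / 5 * h + L\<^sup>2 * (2 + A)"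
            using Kd(3) by (simp add: power2_eq_square algebra_simps)
          also have "\<dots> \<le> L * infdist (a x) Z" using low h2(1) Kd(2) by (simp add: algebra_simps)
          finally have 2: "L * (4 * d + 2 + A) \<le> infdist (a x) Z" using fD(1) by simp
          have "0 \<le> L\<^sup>2 * (2 + A)" using fD(2) by simp
          then have "2 * (1 + A) \<le> h" using h2(1) by argo
          then have "h / 4 \<le> L * infdist (a x) Z" using low Kd(2) fD(2) by argo
          then have "L * \<bar>RZ\<bar> \<le> L * infdist (a x) Z" using h2(2) by argo
          then have "RZ \<le> infdist (a x) Z" using fD(1) by simp
          then show ?thesis using PZ 1 2 by linarith
        qed
        then have "L * dist (P (a x)) (P (a y)) \<le> L * (\<epsilon> * h / (2 * L))"
          using fD(1) by (intro mult_left_mono) auto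
        also have "\<dots> = \<epsilon> * h / 2" using fD(1) by simp
        finally show ?thesis
          using fD(3)[of "P (a x)" "P (a y)"] h1(1) by (simp add: P'_def h_def)
      qed
      then show ?thesis by auto
    qed
  qed
  then show ?thesis using Z(2) by (intro coarse_contraction_imp_contracting) auto
qed

section \<open>Quasi-geodesics near a contracting set\<close>

lemma kappa_threshold_nonempty:
  assumes "sublinear \<rho>" "L \<ge> 1"
  shows "{R. R > 0 \<and> (\<forall>r\<ge>R. 3 * L\<^sup>2 * \<rho> r \<le> r)} \<noteq> {}"
proof -
  have L: "3 * L\<^sup>2 > 0" using assms(2) by simp
  then obtain D where D: "D \<ge> 1" "\<And>r. r \<ge> D \<Longrightarrow> \<rho> r \<le> 1 / (3 * L\<^sup>2) * r"
    using sublinear_eventually_le[OF assms(1), of "1 / (3 * L\<^sup>2)"] by auto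
  have "3 * L\<^sup>2 * \<rho> r \<le> r" if "r \<ge> D" for r
    using D(2)[OF that] L by (simp add: field_simps)
  then have "D \<in> {R. R > 0 \<and> (\<forall>r\<ge>R. 3 * L\<^sup>2 * \<rho> r \<le> r)}" using D(1) by auto
  then show ?thesis by blast
qed

text \<open>The summand 1 in \<open>kappa\<close> matters here: the infimum of the thresholds need
  not be attained, but anything at least \<open>kappa\<close> strictly exceeds it and hence lies
  above an actual threshold.\<close>

lemma kappa_leD:
  assumes "sublinear \<rho>" "L \<ge> 1" "kappa \<rho> L A \<le> x"
  shows "3 * A \<le> x" "3 * L\<^sup>2 \<le> x" "3 * L\<^sup>2 * \<rho> x \<le> x"
proof -
  let ?S = "{R. R > 0 \<and> (\<forall>r\<ge>R. 3 * L\<^sup>2 * \<rho> r \<le> r)}"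
  show "3 * A \<le> x" "3 * L\<^sup>2 \<le> x"
    using assms(3) by (auto simp: kappa_def)
  have "Inf ?S < x" using assms(3) by (auto simp: kappa_def)
  then obtain R where "R \<in> ?S" "R < x"
    using kappa_threshold_nonempty[OF assms(1,2)] by (meson cInf_lessD)
  then show "3 * L\<^sup>2 * \<rho> x \<le> x" by auto
qed

lemma kappa_ge: "3 * A \<le> kappa \<rho> L A" "3 * L\<^sup>2 \<le> kappa \<rho> L A"
  by (auto simp: kappa_def)

lemma kappa_mono:
  assumes "sublinear \<rho>" "1 \<le> L" "L \<le> L'" "A \<le> A'"
  shows "kappa \<rho> L A \<le> kappa \<rho> L' A'"
proof -
  let ?S = "\<lambda>L. {R. R > 0 \<and> (\<forall>r\<ge>R. 3 * L\<^sup>2 * \<rho> r \<le> r)}"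
  have L: "3 * L\<^sup>2 \<le> 3 * L'\<^sup>2" using assms by (simp add: power_mono)
  have "3 * L\<^sup>2 * \<rho> r \<le> r" if "3 * L'\<^sup>2 * \<rho> r \<le> r" "r > 0" for r
  \<comment> \<open>A sublinear function is only eventually nonnegative. Where it is negative, the
    threshold inequality holds trivially for positive \<open>r\<close>.\<close>
  proof (cases "\<rho> r \<ge> 0")
    case True
    then show ?thesis using mult_right_mono[OF L True] that by linarith
  next
    case False
    then have "3 * L\<^sup>2 * \<rho> r \<le> 0" by (intro mult_nonneg_nonpos) auto
    then show ?thesis using that(2) by linarith
  qed
  then have "?S L' \<subseteq> ?S L" by force
  then have "Inf (?S L) \<le> Inf (?S L')"
    using kappa_threshold_nonempty[of \<rho> L'] assms by (intro cInf_superset_mono bdd_belowI[of _ 0]) auto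
  then show ?thesis using L assms(4) by (auto simp: kappa_def)
qed

text \<open>Advance by the time \<open>c = (h - A) / L\<close>, in which the quasi-geodesic moves at
  most the current height h, so one contraction estimate applies. It moves the projection by at most
  \<open>h / (3 * L\<^sup>2)\<close>, and h is at most \<open>3 / 2 * (L * c)\<close>, so the
  projection moves at most \<open>c / (2 * L)\<close> in time c. The terms \<open>A\<close> and
  \<open>infdist (\<beta> b) Z\<close> pay for the last, incomplete step. Since c is at least 2,
  induction on an integer bound for the duration terminates.\<close>

lemma closest_proj_excursion:
  assumes \<rho>: "sublinear \<rho>" "rho_contracting \<rho> Z" and P: "\<And>x. P x \<in> closest_proj Z x"
    and \<beta>: "LA_qi_embedding_on L A {0..} \<beta>"
    and "0 \<le> a" "a \<le> b" "b - a \<le> real n" "\<And>t. a \<le> t \<Longrightarrow> t \<le> b \<Longrightarrow> kappa \<rho> L A \<le> infdist (\<beta> t) Z"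
  shows "dist (P (\<beta> a)) (P (\<beta> b)) \<le> (b - a) / (2 * L) + A + infdist (\<beta> b) Z"
  using assms(5-8)
proof (induction n arbitrary: a)
  note \<beta>D = LA_qi_embedding_onD[OF \<beta>]
  case 0
  then have "a = b" by simp
  then show ?case using \<beta>D(2) infdist_nonneg[of "\<beta> b" Z] by simp
next
  case (Suc n)
  note \<beta>D = LA_qi_embedding_onD[OF \<beta>]
  define h where "h = infdist (\<beta> a) Z"
  define c where "c = (h - A) / L"
  have k: "3 * A \<le> h" "3 * L\<^sup>2 \<le> h" "3 * L\<^sup>2 * \<rho> h \<le> h"
    using kappa_leD[OF \<rho>(1) \<beta>D(1) Suc.prems(4)[of a]] Suc.prems(2) by (auto simp: h_def)
  have LL: "L\<^sup>2 \<ge> 1" "L\<^sup>2 > 0" using \<beta>D(1) one_le_power[of L 2] by auto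
  have \<rho>h: "\<rho> h \<le> h / (3 * L\<^sup>2)" using k(3) LL by (simp add: field_simps)
  have Lc: "L * c = h - A" using \<beta>D(1) by (simp add: c_def)
  have proj: "dist (P (\<beta> a)) (P (\<beta> s)) \<le> h / (3 * L\<^sup>2)" if "a \<le> s" "s \<le> a + c" for s
  proof -
    have "L * \<bar>s - a\<bar> \<le> L * c" using that \<beta>D(1) by (intro mult_left_mono) auto
    then have "dist (\<beta> a) (\<beta> s) \<le> h"
      using \<beta>D(3)[of a s] that Suc.prems(1) Lc by (auto simp: dist_real_def abs_minus_commute)
    then have "dist (P (\<beta> a)) (P (\<beta> s)) \<le> \<rho> h"
      unfolding h_def using P by (intro rho_contractingD[OF \<rho>(2)]) auto
    then show ?thesis using \<rho>h by linarith
  qed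
  show ?case
  proof (cases "b \<le> a + c")
    case True
    have "h \<le> infdist (\<beta> b) Z + L * (b - a) + A"
      using \<beta>D(3)[of a b] Suc.prems(1,2) infdist_triangle[of "\<beta> a" Z "\<beta> b"]
      by (auto simp: h_def dist_real_def abs_minus_commute)
    then have "h / (3 * L\<^sup>2) \<le> (infdist (\<beta> b) Z + L * (b - a) + A) / (3 * L\<^sup>2)"
      by (rule divide_right_mono) simp
    also have "\<dots> = (infdist (\<beta> b) Z + A) / (3 * L\<^sup>2) + (b - a) / (3 * L)"
      using \<beta>D(1) by (simp add: field_simps power2_eq_square)
    also have "(infdist (\<beta> b) Z + A) / (3 * L\<^sup>2) \<le> infdist (\<beta> b) Z + A"
    proof -
      have "1 * (infdist (\<beta> b) Z + A) \<le> 3 * L\<^sup>2 * (infdist (\<beta> b) Z + A)"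
        using LL \<beta>D(2) infdist_nonneg[of "\<beta> b" Z] by (intro mult_right_mono) auto
      then show ?thesis using LL by (simp add: field_simps)
    qed
    also have "(b - a) / (3 * L) \<le> (b - a) / (2 * L)"
      using \<beta>D(1) Suc.prems(2) by (intro divide_left_mono) auto
    finally show ?thesis using proj[of b] True Suc.prems(2) by linarith
  next
    case False
    have hc: "2 * h \<le> 3 * (L * c)" using Lc k(1) by simp
    have "L * (2 * L) \<le> L * c" using hc k(2) by (simp add: power2_eq_square)
    then have c: "2 * L \<le> c" using \<beta>D(1) by simp
    have "b - (a + c) \<le> real n" using Suc.prems(3) c \<beta>D(1) by simp
    then have "dist (P (\<beta> (a + c))) (P (\<beta> b)) \<le> (b - (a + c)) / (2 * L) + A + infdist (\<beta> b) Z"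
      using Suc.prems False c \<beta>D(1) by (intro Suc.IH) auto
    moreover have "dist (P (\<beta> a)) (P (\<beta> (a + c))) \<le> h / (3 * L\<^sup>2)"
      using c \<beta>D(1) by (intro proj) auto
    moreover have "h / (3 * L\<^sup>2) \<le> c / (2 * L)"
      using hc \<beta>D(1) by (simp add: field_simps power2_eq_square)
    moreover have "(b - (a + c)) / (2 * L) = (b - a) / (2 * L) - c / (2 * L)"
      by (simp add: diff_divide_distrib add_divide_distrib)
    ultimately show ?thesis
      using dist_triangle[of "P (\<beta> a)" "P (\<beta> b)" "P (\<beta> (a + c))"] by linarith
  qed
qed

text \<open>The end points are at least about \<open>(b - a) / L\<close> apart, while the route
  through their projections has length at most \<open>(b - a) / (2 * L)\<close> plus terms in the
  heights. Absorbing the half leaves a bound linear in the heights.\<close>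

lemma excursion_length:
  fixes Z :: "'a::heine_borel set" and \<beta> :: "real \<Rightarrow> 'a"
  assumes \<rho>: "sublinear \<rho>" "rho_contracting \<rho> Z" "Z \<noteq> {}"
    and \<beta>: "LA_qi_embedding_on L A {0..} \<beta>"
    and ab: "0 \<le> a" "a \<le> b" "\<And>t. a \<le> t \<Longrightarrow> t \<le> b \<Longrightarrow> kappa \<rho> L A \<le> infdist (\<beta> t) Z"
  shows "b - a \<le> 2 * L * (2 * A + infdist (\<beta> a) Z + 2 * infdist (\<beta> b) Z)"
proof -
  note \<beta>D = LA_qi_embedding_onD[OF \<beta>]
  define P where "P x = (SOME z. z \<in> closest_proj Z x)" for x
  have P: "P x \<in> closest_proj Z x" for x
    unfolding P_def using closest_proj_nonempty[of Z x] \<rho>(2,3)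
    by (auto intro: someI simp: rho_contracting_def)
  have "dist (P (\<beta> a)) (P (\<beta> b)) \<le> (b - a) / (2 * L) + A + infdist (\<beta> b) Z"
    using ab by (intro closest_proj_excursion[OF \<rho>(1,2) P \<beta>, of _ _ "nat \<lceil>b - a\<rceil>"]) auto
  moreover have "dist (\<beta> a) (\<beta> b) \<le> infdist (\<beta> a) Z + dist (P (\<beta> a)) (P (\<beta> b)) + infdist (\<beta> b) Z"
    using P[of "\<beta> a"] P[of "\<beta> b"] dist_triangle[of "\<beta> a" "\<beta> b" "P (\<beta> a)"]
      dist_triangle2[of "P (\<beta> a)" "\<beta> b" "P (\<beta> b)"]
    by (auto simp: closest_proj_def dist_commute)
  ultimately have "dist (\<beta> a) (\<beta> b) + A \<le> infdist (\<beta> a) Z + (b - a) / (2 * L) + 2 * A + 2 * infdist (\<beta> b) Z"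
    by linarith
  then have "L * (dist (\<beta> a) (\<beta> b) + A) \<le> L * (infdist (\<beta> a) Z + (b - a) / (2 * L) + 2 * A + 2 * infdist (\<beta> b) Z)"
    using \<beta>D(1) by (intro mult_left_mono) auto
  also have "\<dots> = (b - a) / 2 + L * (infdist (\<beta> a) Z + 2 * A + 2 * infdist (\<beta> b) Z)"
    using \<beta>D(1) by (simp add: field_simps)
  finally have "b - a \<le> (b - a) / 2 + L * (infdist (\<beta> a) Z + 2 * A + 2 * infdist (\<beta> b) Z)"
    using \<beta>D(4)[of a b] ab by (auto simp: dist_real_def)
  then have "b - a \<le> 2 * (L * (infdist (\<beta> a) Z + 2 * A + 2 * infdist (\<beta> b) Z))" by argo
  then show ?thesis by (simp add: algebra_simps)
qed

section \<open>Level times and confinement of quasi-geodesics near contracting sets\<close>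

lemma last_time_at_level:
  fixes f :: "real \<Rightarrow> real"
  assumes "continuous_on {a..b} f" "a \<le> b" "f a \<le> k" "k \<le> f b"
  shows "\<exists>T\<in>{a..b}. f T = k \<and> (\<forall>t\<in>{T..b}. k \<le> f t)"
proof -
  define S where "S = {t \<in> {a..b}. f t = k}"
  have "compact S"
    unfolding S_def using continuous_closed_preimage_constant[OF assms(1) closed_atLeastAtMost]
    by (auto simp: compact_eq_bounded_closed intro: bounded_subset[OF bounded_closed_interval])
  moreover have "S \<noteq> {}"
    using IVT'[of f a k b] assms by (auto simp: S_def)
  ultimately obtain T where T: "T \<in> S" "\<And>t. t \<in> S \<Longrightarrow> t \<le> T"
    using compact_attains_sup by metis
  have "k \<le> f t" if t: "t \<in> {T..b}" for t
  proof (rule ccontr)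
    assume "\<not> k \<le> f t"
    moreover have "continuous_on {t..b} f"
      using T(1) t by (intro continuous_on_subset[OF assms(1)]) (auto simp: S_def)
    ultimately obtain s where "t \<le> s" "s \<le> b" "f s = k"
      using IVT'[of f t k b] assms(4) t by auto
    then have "s \<in> S" using T(1) t by (auto simp: S_def)
    then have "t = T" using T(2)[of s] \<open>t \<le> s\<close> t by auto
    then show False using \<open>\<not> k \<le> f t\<close> T(1) by (auto simp: S_def)
  qed
  then show ?thesis using T(1) by (auto simp: S_def)
qed

lemma first_time_at_level:
  fixes f :: "real \<Rightarrow> real"
  assumes "continuous_on {a..b} f" "a \<le> b" "f b \<le> k" "k \<le> f a"
  shows "\<exists>T\<in>{a..b}. f T = k \<and> (\<forall>t\<in>{a..T}. k \<le> f t)"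
proof -
  have "continuous_on {- b..- a} (\<lambda>t. f (- t))"
    using assms by (intro continuous_intros continuous_on_compose2[OF assms(1)]) auto
  then obtain T where T: "T \<in> {- b..- a}" "f (- T) = k" "\<And>t. t \<in> {T..- a} \<Longrightarrow> k \<le> f (- t)"
    using last_time_at_level[of "- b" "- a" "\<lambda>t. f (- t)" k] assms by auto
  have "k \<le> f t" if "t \<in> {a..- T}" for t
    using T(3)[of "- t"] that by auto
  then show ?thesis using T by (intro bexI[of _ "- T"]) auto
qed

text \<open>An excursion that starts at height kappa and ends at height at most \<open>B\<close>
  lasts at most \<open>2 * L * (2 * A + kappa \<rho> L A + 2 * B)\<close>. This is the greatest
  height it can reach in that time.\<close>

definition nbhd_bound :: "(real \<Rightarrow> real) \<Rightarrow> real \<Rightarrow> real \<Rightarrow> real \<Rightarrow> real" where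
  "nbhd_bound \<rho> L A B = kappa \<rho> L A + L * (2 * L * (2 * A + kappa \<rho> L A + 2 * B)) + A"

text \<open>If the point at time t is above kappa, it lies on an excursion. Continuity provides the
  last earlier time \<open>T0\<close> at height exactly kappa, and the excursion is followed up to
  the first later such time or, if there is none before b, up to b itself. Its bounded duration
  limits how far the point at t can be from the one at \<open>T0\<close>.\<close>

lemma continuous_quasi_geodesic_near_contracting:
  fixes Z :: "'a::heine_borel set" and \<beta> :: "real \<Rightarrow> 'a"
  assumes \<rho>: "sublinear \<rho>" "rho_contracting \<rho> Z" "Z \<noteq> {}"
    and \<beta>: "LA_qi_embedding_on L A {0..} \<beta>" "continuous_on {0..} \<beta>"
    and start: "infdist (\<beta> 0) Z \<le> kappa \<rho> L A"
    and b: "0 \<le> t" "t \<le> b" "infdist (\<beta> b) Z \<le> B" "kappa \<rho> L A \<le> B"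
  shows "infdist (\<beta> t) Z \<le> nbhd_bound \<rho> L A B"
proof -
  note \<beta>D = LA_qi_embedding_onD[OF \<beta>(1)]
  define k where "k = kappa \<rho> L A"
  have k0: "k \<ge> 0" using kappa_ge(2)[of L \<rho> A] zero_le_power2[of L] unfolding k_def by linarith
  have cont: "continuous_on {x..y} (\<lambda>t. infdist (\<beta> t) Z)" if "0 \<le> x" for x y
    using that by (intro continuous_intros continuous_on_subset[OF \<beta>(2)]) auto
  show ?thesis
  proof (cases "infdist (\<beta> t) Z \<le> k")
    case True
    have "0 \<le> L * (2 * L * (2 * A + k + 2 * B)) + A"
      using \<beta>D(1,2) k0 b(4) by (simp add: k_def)
    then show ?thesis using True by (simp add: nbhd_bound_def k_def)
  next
    case False
    obtain T0 where T0: "T0 \<in> {0..t}" "infdist (\<beta> T0) Z = k" "\<And>s. s \<in> {T0..t} \<Longrightarrow> k \<le> infdist (\<beta> s) Z"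
      using last_time_at_level[OF cont, of 0 t k] b start False by (auto simp: k_def)
    obtain T1 where T1: "T1 \<in> {t..b}" "infdist (\<beta> T1) Z \<le> B" "\<And>s. s \<in> {t..T1} \<Longrightarrow> k \<le> infdist (\<beta> s) Z"
    proof (cases "\<exists>s\<in>{t..b}. infdist (\<beta> s) Z \<le> k")
      case True
      then obtain s where s: "s \<in> {t..b}" "infdist (\<beta> s) Z \<le> k" by blast
      then obtain T where "T \<in> {t..s}" "infdist (\<beta> T) Z = k" "\<And>u. u \<in> {t..T} \<Longrightarrow> k \<le> infdist (\<beta> u) Z"
        using first_time_at_level[OF cont, of t s k] b False by auto
      then show ?thesis using that[of T] s b(4) by (auto simp: k_def)
    next
      case False
      show ?thesis by (rule that[of b]) (use False b in force)+
    qed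
    have far: "k \<le> infdist (\<beta> s) Z" if "T0 \<le> s" "s \<le> T1" for s
      using that T0(3)[of s] T1(3)[of s] by (cases "s \<le> t") auto
    have "T1 - T0 \<le> 2 * L * (2 * A + infdist (\<beta> T0) Z + 2 * infdist (\<beta> T1) Z)"
      using T0(1) T1(1) by (intro excursion_length[OF \<rho> \<beta>(1) _ _ far[unfolded k_def]]) auto
    also have "\<dots> \<le> 2 * L * (2 * A + k + 2 * B)"
      using T0(2) T1(2) \<beta>D(1) by (intro mult_left_mono) auto
    finally have "L * (t - T0) \<le> L * (2 * L * (2 * A + k + 2 * B))"
      using T1(1) \<beta>D(1) by (intro mult_left_mono) auto
    moreover have "infdist (\<beta> t) Z \<le> k + (L * (t - T0) + A)"
      using infdist_triangle'[of "\<beta> t" Z "\<beta> T0"] T0(1,2) \<beta>D(3)[of T0 t] by (auto simp: dist_real_def)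
    ultimately show ?thesis by (simp add: nbhd_bound_def k_def)
  qed
qed

text \<open>An excursion that never ended would have arbitrarily long initial pieces with both end
  heights at most \<open>B\<close>, against the length bound.\<close>

lemma bounded_quasi_geodesic_returns:
  fixes Z :: "'a::heine_borel set" and \<beta> :: "real \<Rightarrow> 'a"
  assumes \<rho>: "sublinear \<rho>" "rho_contracting \<rho> Z" "Z \<noteq> {}"
    and \<beta>: "LA_qi_embedding_on L A {0..} \<beta>"
    and B: "\<And>t. t \<ge> 0 \<Longrightarrow> infdist (\<beta> t) Z \<le> B" and "t \<ge> 0"
  shows "\<exists>b\<ge>t. infdist (\<beta> b) Z \<le> kappa \<rho> L A"
proof (rule ccontr)
  note \<beta>D = LA_qi_embedding_onD[OF \<beta>]
  assume "\<not> ?thesis"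
  then have far: "\<And>b. b \<ge> t \<Longrightarrow> kappa \<rho> L A \<le> infdist (\<beta> b) Z" by force
  define b where "b = t + 2 * L * (2 * A + 3 * B) + 1"
  have B0: "0 \<le> B" using B[OF \<open>t \<ge> 0\<close>] infdist_nonneg[of "\<beta> t" Z] by linarith
  then have "b \<ge> t" using \<beta>D(1,2) by (simp add: b_def)
  then have "b - t \<le> 2 * L * (2 * A + infdist (\<beta> t) Z + 2 * infdist (\<beta> b) Z)"
    using \<open>t \<ge> 0\<close> far by (intro excursion_length[OF \<rho> \<beta>]) auto
  also have "\<dots> \<le> 2 * L * (2 * A + 3 * B)"
    using B[of t] B[of b] \<open>t \<ge> 0\<close> \<open>b \<ge> t\<close> \<beta>D(1) by (intro mult_left_mono) auto
  finally show False by (simp add: b_def)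
qed

text \<open>The conclusion no longer mentions \<open>B\<close>. Lying in a given class provides only
  some finite bound, and this turns it into one that depends on \<open>\<rho>\<close>,
  \<open>L\<close> and \<open>A\<close> alone.\<close>

lemma bounded_quasi_geodesic_near_contracting:
  fixes Z :: "'a::heine_borel set" and \<beta> :: "real \<Rightarrow> 'a"
  assumes \<rho>: "sublinear \<rho>" "rho_contracting \<rho> Z" "Z \<noteq> {}"
    and \<beta>: "LA_qi_embedding_on L A {0..} \<beta>" "continuous_on {0..} \<beta>"
    and start: "infdist (\<beta> 0) Z \<le> kappa \<rho> L A"
    and B: "\<And>t. t \<ge> 0 \<Longrightarrow> infdist (\<beta> t) Z \<le> B" and "t \<ge> 0"
  shows "infdist (\<beta> t) Z \<le> nbhd_bound \<rho> L A (kappa \<rho> L A)"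
proof -
  obtain b where "b \<ge> t" "infdist (\<beta> b) Z \<le> kappa \<rho> L A"
    using bounded_quasi_geodesic_returns[OF \<rho> \<beta>(1) B \<open>t \<ge> 0\<close>] by blast
  then show ?thesis
    using continuous_quasi_geodesic_near_contracting[OF \<rho> \<beta> start \<open>t \<ge> 0\<close>] by blast
qed

section \<open>Rays and boundary classes\<close>

lemma LA_qi_embedding_on_weaken:
  assumes "LA_qi_embedding_on L A S f" "L \<le> L'" "A \<le> A'"
  shows "LA_qi_embedding_on L' A' S f"
proof (rule LA_qi_embedding_onI)
  note f = LA_qi_embedding_onD[OF assms(1)]
  show "L' \<ge> 1" "A' \<ge> 0" using f(1,2) assms(2,3) by auto
  show "dist (f x) (f y) \<le> L' * dist x y + A'" if "x \<in> S" "y \<in> S" for x y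
    using f(3)[OF that] mult_right_mono[OF assms(2) zero_le_dist[of x y]] assms(3) by linarith
  show "dist x y \<le> L' * (dist (f x) (f y) + A')" if "x \<in> S" "y \<in> S" for x y
  proof -
    have "L * (dist (f x) (f y) + A) \<le> L' * (dist (f x) (f y) + A')"
      using f(1,2) assms(2,3) by (intro mult_mono) auto
    then show ?thesis using f(4)[OF that] by linarith
  qed
qed

lemma LA_qi_embedding_on_perturb:
  assumes "LA_qi_embedding_on L A S f" "\<And>x. x \<in> S \<Longrightarrow> dist (g x) (f x) \<le> D" "D \<ge> 0"
  shows "LA_qi_embedding_on L (A + 2 * D) S g"
proof (rule LA_qi_embedding_onI)
  note f = LA_qi_embedding_onD[OF assms(1)]
  show "L \<ge> 1" "A + 2 * D \<ge> 0" using f(1,2) assms(3) by auto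
  have close: "\<bar>dist (g x) (g y) - dist (f x) (f y)\<bar> \<le> 2 * D" if "x \<in> S" "y \<in> S" for x y
  proof -
    have "dist (g x) (g y) \<le> dist (f x) (f y) + 2 * D"
      using assms(2)[OF that(1)] assms(2)[OF that(2)] dist_triangle[of "g x" "g y" "f x"]
        dist_triangle2[of "f x" "g y" "f y"] by (simp add: dist_commute)
    moreover have "dist (f x) (f y) \<le> dist (g x) (g y) + 2 * D"
      using assms(2)[OF that(1)] assms(2)[OF that(2)] dist_triangle[of "f x" "f y" "g x"]
        dist_triangle2[of "g x" "f y" "g y"] by (simp add: dist_commute)
    ultimately show ?thesis by linarith
  qed
  show "dist (g x) (g y) \<le> L * dist x y + (A + 2 * D)" if "x \<in> S" "y \<in> S" for x y
    using f(3)[OF that] close[OF that] by linarith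
  show "dist x y \<le> L * (dist (g x) (g y) + (A + 2 * D))" if "x \<in> S" "y \<in> S" for x y
  proof -
    have "L * (dist (f x) (f y) + A) \<le> L * (dist (g x) (g y) + (A + 2 * D))"
      using f(1) close[OF that] by (intro mult_left_mono) auto
    then show ?thesis using f(4)[OF that] by linarith
  qed
qed

lemma LA_qi_embedding_on_compose:
  assumes "LA_qi_embedding_on L A S f" "LA_qi_embedding_on L' A' UNIV g"
  shows "LA_qi_embedding_on (L' * L) (L' * A + A') S (g \<circ> f)"
proof (rule LA_qi_embedding_onI)
  note f = LA_qi_embedding_onD[OF assms(1)]
  note g = LA_qi_embedding_onD[OF assms(2)]
  show "L' * L \<ge> 1" using mult_mono[of 1 L' 1 L] f(1) g(1) by simp
  show "L' * A + A' \<ge> 0" using f(2) g(1,2) by simp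
  show "dist ((g \<circ> f) x) ((g \<circ> f) y) \<le> L' * L * dist x y + (L' * A + A')" if "x \<in> S" "y \<in> S" for x y
  proof -
    have "L' * dist (f x) (f y) \<le> L' * (L * dist x y + A)"
      using f(3)[OF that] g(1) by (intro mult_left_mono) auto
    then show ?thesis using g(3)[of "f x" "f y"] by (simp add: algebra_simps)
  qed
  show "dist x y \<le> L' * L * (dist ((g \<circ> f) x) ((g \<circ> f) y) + (L' * A + A'))" if "x \<in> S" "y \<in> S" for x y
  proof -
    have A: "A \<le> L' * (L' * A)" using mult_mono[of 1 "L' * L'" A A] mult_mono[of 1 L' 1 L'] f(2) g(1)
      by (simp add: mult.assoc)
    have "L * (dist (f x) (f y) + A) \<le> L * (L' * (dist (g (f x)) (g (f y)) + A') + L' * (L' * A))"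
      using g(4)[of "f x" "f y"] A f(1) by (intro mult_left_mono) auto
    then show ?thesis using f(4)[OF that] by (simp add: algebra_simps)
  qed
qed

text \<open>The composite \<open>f \<circ> \<gamma>\<close> is a perturbation of
  \<open>\<beta>\<close> and so a quasi-isometric embedding with additive constant
  \<open>A + 2 * D\<close>; the two inequalities for \<open>f\<close> then strip \<open>f\<close>
  off.\<close>

lemma LA_qi_embedding_on_lift:
  assumes \<beta>: "LA_qi_embedding_on L A S \<beta>" and f: "LA_qi_embedding_on L' A' UNIV f"
    and close: "\<And>t. t \<in> S \<Longrightarrow> dist (f (\<gamma> t)) (\<beta> t) \<le> D" and "D \<ge> 0"
  shows "LA_qi_embedding_on (L' * L) (L' * (A + 2 * D + A')) S \<gamma>"
proof (rule LA_qi_embedding_onI)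
  have "LA_qi_embedding_on L (A + 2 * D) S (f \<circ> \<gamma>)"
    using close \<open>D \<ge> 0\<close> by (intro LA_qi_embedding_on_perturb[OF \<beta>]) auto
  note g = LA_qi_embedding_onD[OF this, unfolded comp_def]
  note f = LA_qi_embedding_onD[OF f]
  show "L' * L \<ge> 1" using mult_mono[of 1 L' 1 L] f(1) g(1) by simp
  show "L' * (A + 2 * D + A') \<ge> 0" using f(1,2) g(2) by simp
  show "dist (\<gamma> x) (\<gamma> y) \<le> L' * L * dist x y + L' * (A + 2 * D + A')" if "x \<in> S" "y \<in> S" for x y
  proof -
    have "L' * (dist (f (\<gamma> x)) (f (\<gamma> y)) + A') \<le> L' * (L * dist x y + (A + 2 * D) + A')"
      using g(3)[OF that] f(1) by (intro mult_left_mono) auto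
    then show ?thesis using f(4)[of "\<gamma> x" "\<gamma> y"] by (simp add: algebra_simps)
  qed
  show "dist x y \<le> L' * L * (dist (\<gamma> x) (\<gamma> y) + L' * (A + 2 * D + A'))" if "x \<in> S" "y \<in> S" for x y
  proof -
    define E where "E = A + 2 * D + A'"
    have E0: "E \<ge> 0" using f(2) g(2) by (simp add: E_def)
    have "1 \<le> L' * L'" using mult_mono[of 1 L' 1 L'] f(1) by simp
    then have E: "E \<le> L' * L' * E" using mult_right_mono[of 1 "L' * L'" E] E0 by simp
    have "L * (dist (f (\<gamma> x)) (f (\<gamma> y)) + (A + 2 * D)) \<le> L * (L' * dist (\<gamma> x) (\<gamma> y) + L' * L' * E)"
    proof (rule mult_left_mono)
      show "dist (f (\<gamma> x)) (f (\<gamma> y)) + (A + 2 * D) \<le> L' * dist (\<gamma> x) (\<gamma> y) + L' * L' * E"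
        using f(3)[OF UNIV_I UNIV_I, of "\<gamma> x" "\<gamma> y"] E unfolding E_def by linarith
    qed (use g(1) in simp)
    then show ?thesis using g(4)[OF that] by (simp add: algebra_simps E_def)
  qed
qed

text \<open>Join the values at consecutive integers by geodesics, each parametrised proportionally
  over a unit interval. Consecutive values are at most \<open>L + A\<close> apart, which is then a
  Lipschitz constant. Both the new and the old ray move at most \<open>L + A\<close> from the value
  at the preceding integer, whence the factor 2.\<close>

lemma piecewise_geodesic_interpolation:
  fixes \<gamma> :: "real \<Rightarrow> 'a::proper_geodesic_space"
  assumes \<gamma>: "LA_qi_embedding_on L A {0..} \<gamma>"
  shows "\<exists>\<gamma>'. continuous_on {0..} \<gamma>' \<and> \<gamma>' 0 = \<gamma> 0 \<and> (\<forall>t\<ge>0. dist (\<gamma>' t) (\<gamma> t) \<le> 2 * (L + A))"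
proof -
  note \<gamma>D = LA_qi_embedding_onD[OF \<gamma>]
  define M where "M = L + A"
  have M: "M \<ge> 0" using \<gamma>D(1,2) by (simp add: M_def)
  define d where "d n = dist (\<gamma> (real n)) (\<gamma> (real (Suc n)))" for n
  have d: "d n \<le> M" for n using \<gamma>D(3)[of "real n" "real (Suc n)"] by (simp add: d_def M_def dist_real_def)
  have "\<exists>G. \<forall>n. isometric_embedding_on {0..d n} (G n) \<and> G n 0 = \<gamma> (real n) \<and> G n (d n) = \<gamma> (real (Suc n))"
    using geodesic_joining unfolding d_def by (intro choice) blast
  then obtain G where G: "\<And>n. isometric_embedding_on {0..d n} (G n)" "\<And>n. G n 0 = \<gamma> (real n)"
    "\<And>n. G n (d n) = \<gamma> (real (Suc n))" by blast
  define p where "p n u = G n (d n * u)" for n u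
  have p01: "p n 0 = \<gamma> (real n)" "p n 1 = \<gamma> (real (Suc n))" for n
    using G by (auto simp: p_def)
  have p: "dist (p n u) (p n v) \<le> M * \<bar>u - v\<bar>" if "0 \<le> u" "u \<le> 1" "0 \<le> v" "v \<le> 1" for n u v
  proof -
    have dn: "0 \<le> d n" by (simp add: d_def)
    have "d n * u \<in> {0..d n}" "d n * v \<in> {0..d n}"
      using that dn by (auto intro: mult_left_le)
    then have "dist (p n u) (p n v) = \<bar>d n * u - d n * v\<bar>"
      using G(1)[of n] by (simp add: p_def isometric_embedding_on_def dist_real_def)
    also have "\<dots> = d n * \<bar>u - v\<bar>" using dn by (simp add: abs_mult flip: right_diff_distrib)
    also have "\<dots> \<le> M * \<bar>u - v\<bar>" using d by (intro mult_right_mono) auto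
    finally show ?thesis .
  qed
  define \<gamma>' where "\<gamma>' t = p (nat \<lfloor>t\<rfloor>) (t - real (nat \<lfloor>t\<rfloor>))" for t
  \<comment> \<open>The floor assigns an integer time to the piece on its right. Since neighbouring
    pieces agree there, each formula is valid on its whole closed interval.\<close>
  have piece: "\<gamma>' t = p n (t - real n)" if "real n \<le> t" "t \<le> real (Suc n)" for n t
  proof (cases "t = real (Suc n)")
    case True
    then have "nat \<lfloor>t\<rfloor> = Suc n" by (metis floor_of_nat nat_int)
    then show ?thesis using True p01 by (simp add: \<gamma>'_def)
  next
    case False
    then have "\<lfloor>t\<rfloor> = int n" using that by (intro floor_unique) auto
    then show ?thesis by (simp add: \<gamma>'_def)
  qed
  have lip1: "dist (\<gamma>' s) (\<gamma>' t) \<le> M * (t - s)" if "real n \<le> s" "s \<le> t" "t \<le> real (Suc n)" for n s t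
    using p[of "s - real n" "t - real n" n] piece[of n s] piece[of n t] that by simp
  have lip: "\<forall>s t. 0 \<le> s \<longrightarrow> s \<le> t \<longrightarrow> t \<le> real n \<longrightarrow> dist (\<gamma>' s) (\<gamma>' t) \<le> M * (t - s)" for n
  proof (induction n)
    case 0
    show ?case
    proof (intro allI impI)
      fix s t :: real assume "0 \<le> s" "s \<le> t" "t \<le> real 0"
      then have "s = t" by simp
      then show "dist (\<gamma>' s) (\<gamma>' t) \<le> M * (t - s)" by simp
    qed
  next
    case (Suc n)
    show ?case
    proof (intro allI impI)
      fix s t :: real assume st: "0 \<le> s" "s \<le> t" "t \<le> real (Suc n)"
      consider "t \<le> real n" | "real n \<le> s" | "s < real n" "real n < t" by linarith
      then show "dist (\<gamma>' s) (\<gamma>' t) \<le> M * (t - s)"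
      proof cases
        case 3
        have "dist (\<gamma>' s) (\<gamma>' (real n)) \<le> M * (real n - s)" using Suc.IH st 3 by auto
        moreover have "dist (\<gamma>' (real n)) (\<gamma>' t) \<le> M * (t - real n)" using lip1[of n "real n" t] st 3 by auto
        ultimately show ?thesis
          using dist_triangle[of "\<gamma>' s" "\<gamma>' t" "\<gamma>' (real n)"] by (simp add: algebra_simps)
      qed (use Suc.IH lip1 st in auto)
    qed
  qed
  have lip': "dist (\<gamma>' s) (\<gamma>' t) \<le> M * (t - s)" if "0 \<le> s" "s \<le> t" for s t
    using lip[of "nat \<lceil>t\<rceil>"] that real_nat_ceiling_ge[of t] by blast
  have "dist (\<gamma>' s) (\<gamma>' t) \<le> M * dist s t" if "s \<in> {0..}" "t \<in> {0..}" for s t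
    using lip'[of s t] lip'[of t s] that by (cases "s \<le> t") (auto simp: dist_real_def dist_commute)
  then have "M-lipschitz_on {0..} \<gamma>'" using M by (rule lipschitz_onI)
  moreover have "\<gamma>' 0 = \<gamma> 0" using p01(1)[of 0] by (simp add: \<gamma>'_def)
  moreover have "dist (\<gamma>' t) (\<gamma> t) \<le> 2 * (L + A)" if "t \<ge> 0" for t
  proof -
    define n where "n = nat \<lfloor>t\<rfloor>"
    have n: "real n \<le> t" "t \<le> real n + 1" using that by (auto simp: n_def)
    have "\<gamma>' (real n) = \<gamma> (real n)" using piece[of n "real n"] p01 by simp
    then have "dist (\<gamma>' t) (\<gamma> (real n)) \<le> M * (t - real n)"
      using lip'[of "real n" t] n by (simp add: dist_commute)
    moreover have "M * (t - real n) \<le> M" using M n by (intro mult_left_le) auto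
    moreover have "dist (\<gamma> (real n)) (\<gamma> t) \<le> L * (t - real n) + A"
      using \<gamma>D(3)[of "real n" t] n that by (simp add: dist_real_def)
    moreover have "L * (t - real n) \<le> L" using \<gamma>D(1) n by (intro mult_left_le) auto
    ultimately show ?thesis
      using dist_triangle[of "\<gamma>' t" "\<gamma> t" "\<gamma> (real n)"] by (simp add: M_def)
  qed
  ultimately show ?thesis using lipschitz_on_continuous_on by blast
qed

section \<open>Geodesic rays and the classes they represent\<close>

lemma geodesic_rayD:
  assumes "geodesic_ray b \<alpha>"
  shows "LA_qi_embedding_on 1 0 {0..} \<alpha>" "continuous_on {0..} \<alpha>" "\<alpha> 0 = b"
    "\<And>t. t \<ge> 0 \<Longrightarrow> dist (\<alpha> t) b = t" "quasi_geodesic_ray b 1 0 \<alpha>"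
    "\<And>s t. s \<ge> 0 \<Longrightarrow> t \<ge> 0 \<Longrightarrow> dist (\<alpha> s) (\<alpha> t) = \<bar>s - t\<bar>"
proof -
  show d: "dist (\<alpha> s) (\<alpha> t) = \<bar>s - t\<bar>" if "s \<ge> 0" "t \<ge> 0" for s t
    using assms that by (simp add: geodesic_ray_def isometric_embedding_on_def dist_real_def)
  show b: "\<alpha> 0 = b" using assms by (simp add: geodesic_ray_def)
  show "dist (\<alpha> t) b = t" if "t \<ge> 0" for t using d[of t 0] b that by simp
  show q: "LA_qi_embedding_on 1 0 {0..} \<alpha>" using d by (auto simp: LA_qi_embedding_on_def dist_real_def)
  then show "quasi_geodesic_ray b 1 0 \<alpha>" using b by (simp add: quasi_geodesic_ray_def)
  have "1-lipschitz_on {0..} \<alpha>" by (rule lipschitz_onI) (auto simp: d dist_real_def)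
  then show "continuous_on {0..} \<alpha>" by (rule lipschitz_on_continuous_on)
qed

lemma closed_geodesic_ray_image:
  fixes b :: "'a::metric_space"
  assumes "geodesic_ray b \<alpha>"
  shows "closed (\<alpha> ` {0..})"
proof (rule closed_sequential_limits[THEN iffD2], intro allI impI)
  note \<alpha> = geodesic_rayD[OF assms]
  fix x l assume "(\<forall>n. x n \<in> \<alpha> ` {0..}) \<and> x \<longlonglongrightarrow> l"
  then have x: "\<And>n. \<exists>t\<ge>0. x n = \<alpha> t" "x \<longlonglongrightarrow> l" by fastforce+
  then obtain t where t: "\<And>n. t n \<ge> 0" "\<And>n. x n = \<alpha> (t n)" by metis
  have "Cauchy x" using x(2) by (rule LIMSEQ_imp_Cauchy)
  then have "Cauchy t"
    unfolding Cauchy_def using t \<alpha>(6) by (simp add: dist_real_def)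
  then obtain s where s: "t \<longlonglongrightarrow> s" using Cauchy_convergent convergent_def by blast
  then have "s \<ge> 0" using t(1) by (intro LIMSEQ_le_const) auto
  then have "(\<lambda>n. \<alpha> (t n)) \<longlonglongrightarrow> \<alpha> s"
    using \<alpha>(2) s t(1) by (intro continuous_on_tendsto_compose[OF \<alpha>(2) s]) auto
  then have "l = \<alpha> s" using x(2) t(2) LIMSEQ_unique by (metis (no_types, lifting) ext)
  then show "l \<in> \<alpha> ` {0..}" using \<open>s \<ge> 0\<close> by auto
qed

lemma finite_hausdorff_distance_pointwise:
  assumes "\<And>t. t \<in> S \<Longrightarrow> dist (\<gamma> t) (\<beta> t) \<le> C"
  shows "finite_hausdorff_distance (\<gamma> ` S) (\<beta> ` S)"
  unfolding finite_hausdorff_distance_def using assms by (intro exI[of _ C]) auto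

lemma contracting_boundaryD:
  assumes "\<zeta> \<in> contracting_boundary b" "\<gamma> \<in> \<zeta>"
  shows "\<gamma> \<in> contracting_rays b" "\<zeta> = asymptotic b `` {\<gamma>}"
proof -
  note q = equiv_asymptotic[of b]
  show "\<gamma> \<in> contracting_rays b"
    using assms Union_quotient[OF q] unfolding contracting_boundary_def by blast
  show "\<zeta> = asymptotic b `` {\<gamma>}"
    using assms quotientE[of \<zeta> "contracting_rays b" "asymptotic b"] equiv_class_eq[OF q]
    unfolding contracting_boundary_def by (metis Image_singleton_iff)
qed

lemma contracting_boundary_hausdorff:
  assumes "\<zeta> \<in> contracting_boundary b" "\<gamma> \<in> \<zeta>" "\<beta> \<in> \<zeta>"
  shows "finite_hausdorff_distance (\<gamma> ` {0..}) (\<beta> ` {0..})"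
  using contracting_boundaryD(2)[OF assms(1,2)] assms(3) by (auto simp: asymptotic_def)

text \<open>Contraction passes to sets at finite Hausdorff distance, so a quasi-geodesic ray near a
  member of the class is itself contracting and only the distance has to be checked.\<close>

lemma contracting_boundary_mem:
  fixes b :: "'a::proper_geodesic_space"
  assumes "\<zeta> \<in> contracting_boundary b" "\<gamma> \<in> \<zeta>" "quasi_geodesic_ray b L A \<beta>"
    "finite_hausdorff_distance (\<gamma> ` {0..}) (\<beta> ` {0..})"
  shows "\<beta> \<in> \<zeta>"
proof -
  have \<gamma>: "\<gamma> \<in> contracting_rays b" "\<zeta> = asymptotic b `` {\<gamma>}"
    using contracting_boundaryD[OF assms(1,2)] by auto
  have "contracting (\<beta> ` {0..})"
    using \<gamma>(1) assms(4) contracting_finite_hausdorff_distance[of "\<gamma> ` {0..}" "\<beta> ` {0..}"]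
    by (auto simp: contracting_rays_def)
  then have "\<beta> \<in> contracting_rays b" using assms(3) by (auto simp: contracting_rays_def)
  then show ?thesis using \<gamma> assms(4) by (auto simp: asymptotic_def)
qed

lemma class_in_contracting_boundary:
  "\<gamma> \<in> contracting_rays b \<Longrightarrow> asymptotic b `` {\<gamma>} \<in> contracting_boundary b"
  "\<gamma> \<in> contracting_rays b \<Longrightarrow> \<gamma> \<in> asymptotic b `` {\<gamma>}"
  using equiv_class_self[OF equiv_asymptotic[of b]] by (auto simp: contracting_boundary_def quotientI)

text \<open>All geodesic rays of the class lie within one constant of \<open>\<alpha>0\<close>,
  because the unknown Hausdorff distance to \<open>\<alpha>0\<close> is upgraded to a bound in terms
  of a contraction function of \<open>\<alpha>0\<close>. One projection therefore serves all of
  them, and the family is coarsely contracting with common constants.\<close>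

lemma rho_class_sublinear:
  fixes b :: "'a::proper_geodesic_space"
  assumes \<zeta>: "\<zeta> \<in> contracting_boundary b" and \<alpha>0: "\<alpha>0 \<in> \<zeta>" "geodesic_ray b \<alpha>0"
  shows "sublinear (rho_class b \<zeta>)"
    and "\<And>\<alpha>. \<alpha> \<in> \<zeta> \<Longrightarrow> geodesic_ray b \<alpha> \<Longrightarrow> rho_contracting (rho_class b \<zeta>) (\<alpha> ` {0..})"
proof -
  define Z where "Z = \<alpha>0 ` {0..}"
  have Z: "closed Z" "Z \<noteq> {}" using closed_geodesic_ray_image[OF \<alpha>0(2)] by (auto simp: Z_def)
  have cZ: "contracting Z"
    using contracting_boundaryD(1)[OF \<zeta> \<alpha>0(1)] by (simp add: contracting_rays_def Z_def)
  then obtain \<rho> where \<rho>: "sublinear \<rho>" "rho_contracting \<rho> Z"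
    using Z(1) by (auto simp: contracting_def)
  obtain P where P: "coarse_contraction {(Z, P)}"
    using contracting_obtain_projection[OF cZ Z(2)] by blast
  define K where "K = nbhd_bound \<rho> 1 0 (kappa \<rho> 1 0)"
  have near: "\<bar>infdist x Z - infdist x (\<alpha> ` {0..})\<bar> \<le> 2 * K + 2" if \<alpha>: "\<alpha> \<in> \<zeta>" "geodesic_ray b \<alpha>" for \<alpha> x
  proof -
    note \<alpha>D = geodesic_rayD[OF \<alpha>(2)]
    note \<alpha>0D = geodesic_rayD[OF \<alpha>0(2)]
    obtain H where H: "\<And>x. \<bar>infdist x (\<alpha> ` {0..}) - infdist x Z\<bar> \<le> H"
      using finite_hausdorff_distance_infdist[OF contracting_boundary_hausdorff[OF \<zeta> \<alpha>(1) \<alpha>0(1)]]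
      by (auto simp: Z_def)
    have bd: "infdist (\<alpha> t) Z \<le> H" if "t \<ge> 0" for t
      using H[of "\<alpha> t"] that by simp
    have "b \<in> Z" using \<alpha>0D(3) by (auto simp: Z_def)
    then have start: "infdist (\<alpha> 0) Z \<le> kappa \<rho> 1 0"
      using \<alpha>D(3) kappa_ge(1)[of 0 \<rho> 1] by simp
    \<comment> \<open>Both rays measure the distance from the basepoint by their parameter, so a
      point of \<open>\<alpha>0\<close> near \<open>\<alpha> t\<close> has a parameter near t. This
      pointwise comparison gives closeness in both directions.\<close>
    have "dist (\<alpha> t) (\<alpha>0 t) \<le> 2 * K + 2" if t: "t \<ge> 0" for t
    proof -
      have "infdist (\<alpha> t) Z \<le> K"
        unfolding K_def
        by (rule bounded_quasi_geodesic_near_contracting[OF \<rho> Z(2) \<alpha>D(1,2) start bd t])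
      then obtain s where s: "s \<ge> 0" "dist (\<alpha> t) (\<alpha>0 s) < K + 1"
        using infdist_less_obtain[of "\<alpha> t" Z "K + 1"] Z(2) by (auto simp: Z_def)
      have "t = dist (\<alpha> t) b" "s = dist (\<alpha>0 s) b" using \<alpha>D(4) \<alpha>0D(4) t s by auto
      then have "\<bar>s - t\<bar> < K + 1"
        using s(2) dist_triangle[of "\<alpha> t" b "\<alpha>0 s"] dist_triangle3[of "\<alpha>0 s" b "\<alpha> t"] by (simp add: dist_commute) 
      then show ?thesis
        using dist_triangle[of "\<alpha> t" "\<alpha>0 t" "\<alpha>0 s"] \<alpha>0D(6)[OF s(1) t] s(2) by linarith
    qed
    then have "infdist x Z \<le> infdist x (\<alpha> ` {0..}) + (2 * K + 2)"
      "infdist x (\<alpha> ` {0..}) \<le> infdist x Z + (2 * K + 2)"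
      by (auto intro!: infdist_le_of_close bexI simp: Z_def dist_commute)
    then show ?thesis by linarith
  qed
  define F where "F = (\<lambda>\<alpha>. (\<alpha> ` {0..}, P)) ` {\<alpha> \<in> \<zeta>. geodesic_ray b \<alpha>}"
  have F: "coarse_contraction F"
    using near by (intro coarse_contraction_close[OF P, of _ "2 * K + 2"]) (auto simp: F_def)
  have eq: "rho_class b \<zeta> = sup_diam (fst ` F)"
  proof -
    have fst_F: "fst ` F = (\<lambda>\<alpha>. \<alpha> ` {0..}) ` {\<alpha> \<in> \<zeta>. geodesic_ray b \<alpha>}"
      by (simp add: F_def image_image)
    \<comment> \<open>The diameter and the two conditions are abstracted to arbitrary
      \<open>D\<close>, \<open>P1\<close>, \<open>P2\<close>, so that only the passage from rays to
      their images remains to be shown.\<close>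
    have "(\<exists>\<alpha> x y. u = D (\<alpha> ` {0..}) x y \<and> \<alpha> \<in> \<zeta> \<and> geodesic_ray b \<alpha> \<and> P1 (\<alpha> ` {0..}) x y \<and> P2 (\<alpha> ` {0..}) x)
      \<longleftrightarrow> (\<exists>Z x y. u = D Z x y \<and> Z \<in> fst ` F \<and> P1 Z x y \<and> P2 Z x)"
      for u :: real and D :: "'a set \<Rightarrow> 'a \<Rightarrow> 'a \<Rightarrow> real" and P1 :: "'a set \<Rightarrow> 'a \<Rightarrow> 'a \<Rightarrow> bool"
        and P2 :: "'a set \<Rightarrow> 'a \<Rightarrow> bool"
      unfolding fst_F by blast
    note * = this[of _ "\<lambda>Z x y. diameter (closest_proj Z x \<union> closest_proj Z y)"
        "\<lambda>Z x y. dist x y \<le> infdist x Z" "\<lambda>Z x. infdist x Z \<le> _"]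
    show ?thesis
      unfolding rho_class_def sup_diam_def by (intro ext arg_cong[of _ _ Sup] Collect_cong *)
  qed
  have "F \<noteq> {}" "\<And>Z P. (Z, P) \<in> F \<Longrightarrow> closed Z" "\<And>Z P. (Z, P) \<in> F \<Longrightarrow> Z \<noteq> {}"
    using \<alpha>0 closed_geodesic_ray_image by (auto simp: F_def)
  note * = coarse_contraction_imp_sublinear[OF F this]
  show "sublinear (rho_class b \<zeta>)" unfolding eq by (rule *(1))
  show "rho_contracting (rho_class b \<zeta>) (\<alpha> ` {0..})" if "\<alpha> \<in> \<zeta>" "geodesic_ray b \<alpha>" for \<alpha>
    unfolding eq by (rule *(2)[where P = P]) (use that in \<open>auto simp: F_def\<close>)
qed

section \<open>Neighbourhoods in the topology of fellow-travelling quasi-geodesics\<close>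

text \<open>Go back from t to the last time \<open>T\<close> at height kappa, unless the point is
  already that low. The excursion in between is short because it ends at height at most
  \<open>C\<close>, so the point at \<open>T\<close> is still at distance at least
  \<open>r + kappa\<close> from the basepoint. Its closest point on the ray then lies beyond
  \<open>r\<close>.\<close>

lemma setdist_ray_tail_le_kappa:
  fixes b :: "'a::proper_geodesic_space"
  assumes \<rho>: "sublinear \<rho>" "rho_contracting \<rho> (\<alpha> ` {0..})" and \<alpha>: "geodesic_ray b \<alpha>"
    and \<beta>: "quasi_geodesic_ray b L A \<beta>" "continuous_on {0..} \<beta>"
    and t: "t \<ge> 0" "infdist (\<beta> t) (\<alpha> ` {0..}) \<le> C" "C \<ge> 0"
    and far: "r + kappa \<rho> L A + L * (2 * L * (2 * A + kappa \<rho> L A + 2 * C)) + A \<le> dist (\<beta> t) b"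
  shows "setdist (\<beta> ` {0..}) {x \<in> \<alpha> ` {0..}. dist x b \<ge> r} \<le> kappa \<rho> L A"
proof -
  define Z where "Z = \<alpha> ` {0..}"
  define k where "k = kappa \<rho> L A"
  have Z: "closed Z" "Z \<noteq> {}" "b \<in> Z"
    using closed_geodesic_ray_image[OF \<alpha>] geodesic_rayD(3)[OF \<alpha>] by (auto simp: Z_def)
  have q: "LA_qi_embedding_on L A {0..} \<beta>" "\<beta> 0 = b" using \<beta>(1) by (auto simp: quasi_geodesic_ray_def)
  note \<beta>D = LA_qi_embedding_onD[OF q(1)]
  have k0: "k \<ge> 0" using kappa_ge(2)[of L \<rho> A] zero_le_power2[of L] unfolding k_def by linarith
  have "\<exists>T\<ge>0. infdist (\<beta> T) Z \<le> k \<and> r + k \<le> dist (\<beta> T) b"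
  proof (cases "infdist (\<beta> t) Z \<le> k")
    case True
    have "0 \<le> L * (2 * L * (2 * A + k + 2 * C)) + A" using \<beta>D(1,2) k0 t(3) by simp
    then show ?thesis using True t(1) far by (intro exI[of _ t]) (auto simp: k_def)
  next
    case False
    have "continuous_on {0..t} (\<lambda>t. infdist (\<beta> t) Z)"
      by (intro continuous_intros continuous_on_subset[OF \<beta>(2)]) auto
    then obtain T where T: "T \<in> {0..t}" "infdist (\<beta> T) Z = k" "\<And>s. T \<le> s \<Longrightarrow> s \<le> t \<Longrightarrow> k \<le> infdist (\<beta> s) Z"
      using last_time_at_level[of 0 t "\<lambda>t. infdist (\<beta> t) Z" k] t(1) False q(2) Z(3) k0 by auto
    have "t - T \<le> 2 * L * (2 * A + infdist (\<beta> T) Z + 2 * infdist (\<beta> t) Z)"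
      using T(1) by (intro excursion_length[OF \<rho>[folded Z_def] Z(2) q(1) _ _ T(3)[unfolded k_def]]) auto
    also have "\<dots> \<le> 2 * L * (2 * A + k + 2 * C)"
      using T(2) t(2) \<beta>D(1) by (intro mult_left_mono) (auto simp: Z_def)
    finally have "L * (t - T) \<le> L * (2 * L * (2 * A + k + 2 * C))"
      using \<beta>D(1) by (intro mult_left_mono) auto
    then have "dist (\<beta> t) (\<beta> T) \<le> L * (2 * L * (2 * A + k + 2 * C)) + A"
      using \<beta>D(3)[of t T] T(1) by (auto simp: dist_real_def)
    then have "r + k \<le> dist (\<beta> T) b"
      using far dist_triangle[of "\<beta> t" b "\<beta> T"] by (simp add: k_def)
    then show ?thesis using T by auto
  qed
  then obtain T where T: "T \<ge> 0" "infdist (\<beta> T) Z \<le> k" "r + k \<le> dist (\<beta> T) b" by blast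
  obtain z where z: "z \<in> closest_proj Z (\<beta> T)" using closest_proj_nonempty[OF Z(1,2)] by blast
  have dz: "dist (\<beta> T) z \<le> k" "z \<in> Z" using z T(2) by (auto simp: closest_proj_def)
  moreover have "dist z b \<ge> r" using dz(1) T(3) dist_triangle[of "\<beta> T" b z] by linarith
  ultimately have "setdist (\<beta> ` {0..}) {x \<in> Z. dist x b \<ge> r} \<le> dist (\<beta> T) z"
    using T(1) by (intro setdist_le_dist) auto
  then show ?thesis using dz(1) by (simp add: Z_def k_def)
qed

text \<open>If \<open>r\<close> is at most \<open>3 * L\<^sup>2\<close> or \<open>3 * A\<close>,
  then kappa is at least \<open>r\<close>, and the distance from the basepoint, where the
  quasi-geodesic starts, to the point at parameter \<open>r\<close> already satisfies the condition.
  In the remaining case \<open>L\<close> and \<open>A\<close> are below \<open>r\<close>, so testing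
  \<open>(r, r)\<close>-quasi-geodesics covers all constants with a single \<open>R\<close>.\<close>

lemma FQ_nbhd_criterion:
  fixes b :: "'a::proper_geodesic_space"
  assumes \<alpha>: "geodesic_choice b \<alpha>" and \<zeta>: "\<zeta> \<in> contracting_boundary b" and r: "r \<ge> 1" and C: "C \<ge> 0"
  shows "\<exists>R. \<forall>\<eta>\<in>contracting_boundary b.
    (\<forall>\<beta>\<in>\<eta>. continuous_on {0..} \<beta> \<longrightarrow> quasi_geodesic_ray b r r \<beta> \<longrightarrow>
      (\<exists>t\<ge>0. infdist (\<beta> t) (\<alpha> \<zeta> ` {0..}) \<le> C \<and> R \<le> dist (\<beta> t) b)) \<longrightarrow>
    \<eta> \<in> FQ_nbhd b \<alpha> \<zeta> r"
proof -
  have g: "\<alpha> \<zeta> \<in> \<zeta>" "geodesic_ray b (\<alpha> \<zeta>)" using \<alpha> \<zeta> by (auto simp: geodesic_choice_def)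
  note gD = geodesic_rayD[OF g(2)]
  define \<rho> where "\<rho> = rho_class b \<zeta>"
  have \<rho>: "sublinear \<rho>" "rho_contracting \<rho> (\<alpha> \<zeta> ` {0..})"
    unfolding \<rho>_def using rho_class_sublinear[OF \<zeta> g] g by auto
  define k where "k = kappa \<rho> r r"
  define R where "R = r + k + r * (2 * r * (2 * r + k + 2 * C)) + r"
  have "\<eta> \<in> FQ_nbhd b \<alpha> \<zeta> r"
    if \<eta>: "\<eta> \<in> contracting_boundary b"
      and near: "\<And>\<beta>. \<beta> \<in> \<eta> \<Longrightarrow> continuous_on {0..} \<beta> \<Longrightarrow> quasi_geodesic_ray b r r \<beta> \<Longrightarrow>
        \<exists>t\<ge>0. infdist (\<beta> t) (\<alpha> \<zeta> ` {0..}) \<le> C \<and> R \<le> dist (\<beta> t) b" for \<eta>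
    unfolding FQ_nbhd_def mem_Collect_eq
  proof (intro conjI \<eta> allI impI ballI)
    fix L A \<beta> assume L: "L \<ge> 1" "A \<ge> 0" and \<beta>: "\<beta> \<in> \<eta>"
      and "continuous_on {0..} \<beta> \<and> quasi_geodesic_ray b L A \<beta>"
    then have c: "continuous_on {0..} \<beta>" and q: "quasi_geodesic_ray b L A \<beta>" by auto
    show "setdist (\<beta> ` {0..}) {x \<in> \<alpha> \<zeta> ` {0..}. r \<le> dist x b} \<le> kappa (rho_class b \<zeta>) L A"
    proof (cases "r \<le> 3 * L\<^sup>2 \<or> r \<le> 3 * A")
      case True
      have "setdist (\<beta> ` {0..}) {x \<in> \<alpha> \<zeta> ` {0..}. r \<le> dist x b} \<le> dist (\<beta> 0) (\<alpha> \<zeta> r)"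
        using gD(4)[of r] r by (intro setdist_le_dist) auto
      also have "\<dots> = r" using q gD(4)[of r] r by (simp add: quasi_geodesic_ray_def dist_commute)
      also have "r \<le> kappa (rho_class b \<zeta>) L A"
        using True kappa_ge[of A "rho_class b \<zeta>" L] kappa_ge(2)[of L "rho_class b \<zeta>" A] by linarith
      finally show ?thesis .
    next
      case False
      have "L \<le> L\<^sup>2" using L(1) by (simp add: power2_eq_square)
      moreover have "0 \<le> L\<^sup>2" by simp
      ultimately have Lr: "L \<le> r" "A \<le> r" using False L(2) by linarith+
      have "quasi_geodesic_ray b r r \<beta>"
        using q LA_qi_embedding_on_weaken[OF _ Lr] by (auto simp: quasi_geodesic_ray_def)
      then obtain t where t: "t \<ge> 0" "infdist (\<beta> t) (\<alpha> \<zeta> ` {0..}) \<le> C" "R \<le> dist (\<beta> t) b"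
        using near[OF \<beta> c] by blast
      have kk: "kappa \<rho> L A \<le> k" unfolding k_def using \<rho>(1) L Lr by (intro kappa_mono) auto
      have k0: "0 \<le> kappa \<rho> L A" using kappa_ge(1)[of A \<rho> L] L(2) by linarith
      have "L * (2 * L * (2 * A + kappa \<rho> L A + 2 * C)) \<le> r * (2 * r * (2 * r + k + 2 * C))"
        using L Lr kk k0 C by (intro mult_mono add_mono mult_nonneg_nonneg) auto
      then have "r + kappa \<rho> L A + L * (2 * L * (2 * A + kappa \<rho> L A + 2 * C)) + A \<le> dist (\<beta> t) b"
        using t(3) kk Lr(2) unfolding R_def by linarith
      then show ?thesis
        using setdist_ray_tail_le_kappa[OF \<rho> g(2) q c t(1,2) C] by (simp add: \<rho>_def)
    qed
  qed
  then show ?thesis by blast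
qed

text \<open>For fixed \<open>L\<close> and \<open>A\<close> the constant \<open>C\<close> is
  independent of \<open>R\<close>, of the class and of the ray. The ray may be discontinuous: its
  geodesic interpolation lies in the same class, satisfies the neighbourhood condition with enlarged
  constants, and stays boundedly close.\<close>

lemma FQ_nbhdD:
  fixes b :: "'a::proper_geodesic_space"
  assumes \<alpha>: "geodesic_choice b \<alpha>" and \<zeta>: "\<zeta> \<in> contracting_boundary b"
  shows "\<exists>C\<ge>0. \<forall>R. \<forall>\<eta>\<in>FQ_nbhd b \<alpha> \<zeta> R. \<forall>\<beta>\<in>\<eta>. quasi_geodesic_ray b L A \<beta> \<longrightarrow>
    (\<exists>t\<ge>0. infdist (\<beta> t) (\<alpha> \<zeta> ` {0..}) \<le> C \<and> R \<le> dist (\<beta> t) b + C)"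
proof -
  have g: "\<alpha> \<zeta> \<in> \<zeta>" "geodesic_ray b (\<alpha> \<zeta>)" using \<alpha> \<zeta> by (auto simp: geodesic_choice_def)
  note gD = geodesic_rayD[OF g(2)]
  define D where "D = 2 * (L + A)"
  \<comment> \<open>The summand \<open>D\<close> pays for returning from the interpolation to the
    ray, and 1 for the fact that \<open>setdist\<close> need not be attained.\<close>
  define C where "C = max 0 (kappa (rho_class b \<zeta>) L (A + 2 * D) + 1 + D)"
  have "\<exists>t\<ge>0. infdist (\<beta> t) (\<alpha> \<zeta> ` {0..}) \<le> C \<and> R \<le> dist (\<beta> t) b + C"
    if \<eta>: "\<eta> \<in> FQ_nbhd b \<alpha> \<zeta> R" and \<beta>: "\<beta> \<in> \<eta>" "quasi_geodesic_ray b L A \<beta>" for R \<eta> \<beta>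
  proof -
    have q: "LA_qi_embedding_on L A {0..} \<beta>" "\<beta> 0 = b" using \<beta>(2) by (auto simp: quasi_geodesic_ray_def)
    note qD = LA_qi_embedding_onD[OF q(1)]
    have D: "D \<ge> 0" using qD(1,2) by (simp add: D_def)
    obtain \<beta>' where \<beta>': "continuous_on {0..} \<beta>'" "\<beta>' 0 = b" "\<And>t. t \<ge> 0 \<Longrightarrow> dist (\<beta>' t) (\<beta> t) \<le> D"
      using piecewise_geodesic_interpolation[OF q(1)] q(2) by (auto simp: D_def)
    have q': "quasi_geodesic_ray b L (A + 2 * D) \<beta>'"
      using LA_qi_embedding_on_perturb[OF q(1) \<beta>'(3) D] \<beta>'(2) by (simp add: quasi_geodesic_ray_def)
    have "finite_hausdorff_distance (\<beta> ` {0..}) (\<beta>' ` {0..})"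
      using \<beta>'(3) by (intro finite_hausdorff_distance_pointwise[of _ _ _ D]) (auto simp: dist_commute)
    then have "\<beta>' \<in> \<eta>"
      using contracting_boundary_mem[OF _ \<beta>(1) q'] \<eta> by (simp add: FQ_nbhd_def)
    then have "setdist (\<beta>' ` {0..}) {x \<in> \<alpha> \<zeta> ` {0..}. dist x b \<ge> R} \<le> kappa (rho_class b \<zeta>) L (A + 2 * D)"
      using \<eta> \<beta>'(1) q' qD(1,2) D by (auto simp: FQ_nbhd_def)
    then have "setdist (\<beta>' ` {0..}) {x \<in> \<alpha> \<zeta> ` {0..}. dist x b \<ge> R} < kappa (rho_class b \<zeta>) L (A + 2 * D) + 1"
      by linarith
    moreover have "\<alpha> \<zeta> (max 0 R) \<in> {x \<in> \<alpha> \<zeta> ` {0..}. dist x b \<ge> R}"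
      using gD(4)[of "max 0 R"] by auto
    ultimately obtain t y where ty: "t \<ge> 0" "y \<in> \<alpha> \<zeta> ` {0..}" "dist y b \<ge> R"
        "dist (\<beta>' t) y < kappa (rho_class b \<zeta>) L (A + 2 * D) + 1"
      by (elim setdist_ltE) (auto 4 3)
    then have "dist (\<beta> t) y \<le> C"
      using dist_triangle[of "\<beta> t" y "\<beta>' t"] \<beta>'(3)[OF ty(1)] by (simp add: C_def dist_commute)
    then show ?thesis
      using ty infdist_le[OF ty(2), of "\<beta> t"] dist_triangle[of y b "\<beta> t"]
      by (intro exI[of _ t]) (auto simp: dist_commute)
  qed
  then show ?thesis by (intro exI[of _ C]) (auto simp: C_def)
qed

section \<open>The boundary map\<close>

lemma finite_hausdorff_distance_qi_preimage:
  assumes f: "LA_qi_embedding_on L A UNIV f" and "finite_hausdorff_distance (f ` S) (f ` T)"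
  shows "finite_hausdorff_distance S T"
proof -
  note fD = LA_qi_embedding_onD[OF f]
  obtain C where C: "\<forall>s\<in>S. \<exists>t\<in>T. dist (f s) (f t) \<le> C" "\<forall>t\<in>T. \<exists>s\<in>S. dist (f s) (f t) \<le> C"
    using assms(2) unfolding finite_hausdorff_distance_def by auto
  have "dist s t \<le> L * (C + A)" if "dist (f s) (f t) \<le> C" for s t
  proof -
    have "L * (dist (f s) (f t) + A) \<le> L * (C + A)" using that fD(1) by simp
    then show ?thesis using fD(4)[of s t] by simp
  qed
  then show ?thesis
    unfolding finite_hausdorff_distance_def using C by (intro exI[of _ "L * (C + A)"]) meson
qed

locale contracting_qi_embedding =
  fixes \<phi> :: "'a::proper_geodesic_space \<Rightarrow> 'b::proper_geodesic_space"
    and b :: 'a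
    and \<alpha> :: "(real \<Rightarrow> 'a) set \<Rightarrow> real \<Rightarrow> 'a"
    and \<alpha>' :: "(real \<Rightarrow> 'b) set \<Rightarrow> real \<Rightarrow> 'b"
    and L A :: real
  assumes \<phi>: "LA_qi_embedding_on L A UNIV \<phi>"
    and contracting_range: "contracting (range \<phi>)"
    and \<alpha>: "geodesic_choice b \<alpha>"
    and \<alpha>': "geodesic_choice (\<phi> b) \<alpha>'"
begin

abbreviation "F \<equiv> boundary_map b \<phi>"
abbreviation "X \<equiv> contracting_boundary b"
abbreviation "X' \<equiv> contracting_boundary (\<phi> b)"
abbreviation "U \<equiv> FQ_nbhd b \<alpha>"
abbreviation "U' \<equiv> FQ_nbhd (\<phi> b) \<alpha>'"

section \<open>The boundary map on classes of rays\<close>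

lemmas \<phi>D = LA_qi_embedding_onD[OF \<phi>, simplified]

lemma choice_mem: "\<zeta> \<in> X \<Longrightarrow> \<alpha> \<zeta> \<in> \<zeta>" "\<zeta> \<in> X \<Longrightarrow> geodesic_ray b (\<alpha> \<zeta>)"
  "\<zeta>' \<in> X' \<Longrightarrow> \<alpha>' \<zeta>' \<in> \<zeta>'" "\<zeta>' \<in> X' \<Longrightarrow> geodesic_ray (\<phi> b) (\<alpha>' \<zeta>')"
  using \<alpha> \<alpha>' by (auto simp: geodesic_choice_def)

lemma quasi_geodesic_ray_image:
  "quasi_geodesic_ray b L1 A1 \<gamma> \<Longrightarrow> quasi_geodesic_ray (\<phi> b) (L * L1) (L * A1 + A) (\<phi> \<circ> \<gamma>)"
  using LA_qi_embedding_on_compose[OF _ \<phi>] by (auto simp: quasi_geodesic_ray_def)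

lemma image_contracting_ray:
  assumes "\<gamma> \<in> contracting_rays b"
  shows "\<phi> \<circ> \<gamma> \<in> contracting_rays (\<phi> b)"
proof -
  obtain L1 A1 where "quasi_geodesic_ray b L1 A1 \<gamma>" "contracting (\<gamma> ` {0..})"
    using assms by (auto simp: contracting_rays_def)
  then show ?thesis
    using quasi_geodesic_ray_image[of L1 A1 \<gamma>] contracting_qi_image[OF \<phi> contracting_range, of "\<gamma> ` {0..}"]
    by (auto simp: contracting_rays_def image_comp simp del: o_apply)
qed

lemma boundary_map_class:
  assumes "\<gamma> \<in> contracting_rays b"
  shows "F (asymptotic b `` {\<gamma>}) = asymptotic (\<phi> b) `` {\<phi> \<circ> \<gamma>}"
  using \<phi> assms image_contracting_ray
  by (intro boundary_map_eq) (auto simp: quasi_isometric_embedding_def)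

lemma boundary_map_mem:
  assumes "\<zeta> \<in> X" "\<gamma> \<in> \<zeta>"
  shows "\<phi> \<circ> \<gamma> \<in> F \<zeta>"
  using contracting_boundaryD[OF assms] boundary_map_class image_contracting_ray
    class_in_contracting_boundary(2)[of "\<phi> \<circ> \<gamma>" "\<phi> b"] by metis

lemma boundary_map_in: "\<zeta> \<in> X \<Longrightarrow> F \<zeta> \<in> X'"
  using contracting_boundaryD[OF _ choice_mem(1), of \<zeta>] boundary_map_class image_contracting_ray
    class_in_contracting_boundary(1)[of "\<phi> \<circ> \<alpha> \<zeta>" "\<phi> b"] by metis

text \<open>This recognises lifts: Hausdorff distance is transported back along the embedding, so a
  quasi-geodesic whose image fellow-travels a member of the image class belongs to the original
  class.\<close>

lemma boundary_map_mem_back: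
  assumes \<zeta>: "\<zeta> \<in> X" and q: "quasi_geodesic_ray b L1 A1 \<gamma>"
    and \<beta>: "\<beta> \<in> F \<zeta>" "finite_hausdorff_distance (\<beta> ` {0..}) ((\<phi> \<circ> \<gamma>) ` {0..})"
  shows "\<gamma> \<in> \<zeta>"
proof -
  have "finite_hausdorff_distance ((\<phi> \<circ> \<alpha> \<zeta>) ` {0..}) (\<beta> ` {0..})"
    using contracting_boundary_hausdorff[OF boundary_map_in[OF \<zeta>] boundary_map_mem[OF \<zeta>] \<beta>(1)]
      choice_mem(1)[OF \<zeta>] by blast
  then have "finite_hausdorff_distance ((\<phi> \<circ> \<alpha> \<zeta>) ` {0..}) ((\<phi> \<circ> \<gamma>) ` {0..})"
    using \<beta>(2) by (rule finite_hausdorff_distance_trans)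
  then have "finite_hausdorff_distance (\<alpha> \<zeta> ` {0..}) (\<gamma> ` {0..})"
    by (intro finite_hausdorff_distance_qi_preimage[OF \<phi>]) (simp add: image_comp)
  then show ?thesis using contracting_boundary_mem[OF \<zeta> choice_mem(1)[OF \<zeta>] q] by blast
qed

lemma inj_on_boundary_map: "inj_on F X"
proof (rule inj_onI)
  fix \<zeta> \<eta> assume \<zeta>: "\<zeta> \<in> X" and \<eta>: "\<eta> \<in> X" and eq: "F \<zeta> = F \<eta>"
  have "\<phi> \<circ> \<alpha> \<zeta> \<in> F \<eta>" using boundary_map_mem[OF \<zeta> choice_mem(1)[OF \<zeta>]] eq by simp
  then have "\<alpha> \<zeta> \<in> \<eta>"
    using boundary_map_mem_back[OF \<eta> geodesic_rayD(5)[OF choice_mem(2)[OF \<zeta>]]]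
      finite_hausdorff_distance_refl by blast
  then show "\<zeta> = \<eta>"
    using contracting_boundaryD(2) \<zeta> \<eta> choice_mem(1)[OF \<zeta>] by metis
qed

section \<open>Quasi-geodesics near the range and their lifts\<close>

lemma contracting_rangeE:
  obtains \<rho> where "sublinear \<rho>" "rho_contracting \<rho> (closure (range \<phi>))" "closure (range \<phi>) \<noteq> {}"
  using contracting_range unfolding contracting_def by auto

text \<open>\<open>K\<close> is chosen before the ray and its bound \<open>B\<close>. A member of an
  image class is known to stay near the range only up to a bound depending on that ray; this makes
  the bound, and hence the constants of the lift, uniform.\<close>

lemma quasi_geodesic_ray_near_range:
  "\<exists>K\<ge>0. \<forall>\<beta> B. quasi_geodesic_ray (\<phi> b) L1 A1 \<beta> \<longrightarrow> continuous_on {0..} \<beta> \<longrightarrow>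
    (\<forall>t\<ge>0. infdist (\<beta> t) (range \<phi>) \<le> B) \<longrightarrow> (\<forall>t\<ge>0. infdist (\<beta> t) (range \<phi>) \<le> K)"
proof -
  obtain \<rho> where \<rho>: "sublinear \<rho>" "rho_contracting \<rho> (closure (range \<phi>))" "closure (range \<phi>) \<noteq> {}"
    by (rule contracting_rangeE)
  define K where "K = max 0 (nbhd_bound \<rho> L1 A1 (kappa \<rho> L1 A1))"
  have "infdist (\<beta> t) (range \<phi>) \<le> K"
    if \<beta>: "quasi_geodesic_ray (\<phi> b) L1 A1 \<beta>" "continuous_on {0..} \<beta>"
      and B: "\<forall>t\<ge>0. infdist (\<beta> t) (range \<phi>) \<le> B" and t: "t \<ge> 0" for \<beta> B t
  proof -
    have q: "LA_qi_embedding_on L1 A1 {0..} \<beta>" "\<beta> 0 = \<phi> b" using \<beta>(1) by (auto simp: quasi_geodesic_ray_def)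
    have start: "infdist (\<beta> 0) (closure (range \<phi>)) \<le> kappa \<rho> L1 A1"
      using q(2) kappa_ge(1)[of A1 \<rho> L1] LA_qi_embedding_onD(2)[OF q(1)] by simp
    have "infdist (\<beta> t) (closure (range \<phi>)) \<le> nbhd_bound \<rho> L1 A1 (kappa \<rho> L1 A1)"
      using B by (intro bounded_quasi_geodesic_near_contracting[OF \<rho> q(1) \<beta>(2) start _ t, of B]) auto
    then show ?thesis by (simp add: K_def)
  qed
  then show ?thesis by (intro exI[of _ K]) (auto simp: K_def)
qed

text \<open>The range need not be closed, so a preimage is chosen within \<open>K + 1\<close> of
  each point. At time 0 the choice is forced to be \<open>b\<close>, to keep the lift based
  there.\<close>

lemma quasi_geodesic_ray_lift:
  assumes \<beta>: "quasi_geodesic_ray (\<phi> b) L1 A1 \<beta>" and K: "\<And>t. t \<ge> 0 \<Longrightarrow> infdist (\<beta> t) (range \<phi>) \<le> K" "K \<ge> 0"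
  shows "\<exists>\<gamma>. quasi_geodesic_ray b (L * L1) (L * (A1 + 2 * (K + 1) + A)) \<gamma> \<and>
    (\<forall>t\<ge>0. dist (\<phi> (\<gamma> t)) (\<beta> t) \<le> K + 1)"
proof -
  have q: "LA_qi_embedding_on L1 A1 {0..} \<beta>" "\<beta> 0 = \<phi> b" using \<beta> by (auto simp: quasi_geodesic_ray_def)
  have "\<exists>x. dist (\<phi> x) (\<beta> t) \<le> K + 1 \<and> (t = 0 \<longrightarrow> x = b)" if t: "t \<ge> 0" for t
  proof (cases "t = 0")
    case True
    then show ?thesis using q(2) K(2) by auto
  next
    case False
    have "infdist (\<beta> t) (range \<phi>) < K + 1" using K(1)[OF t] by simp
    then obtain x where "dist (\<beta> t) (\<phi> x) < K + 1"
      using infdist_less_obtain[of "\<beta> t" "range \<phi>" "K + 1"] by auto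
    then show ?thesis using False by (auto simp: dist_commute intro: less_imp_le)
  qed
  then obtain \<gamma> where \<gamma>: "\<And>t. t \<ge> 0 \<Longrightarrow> dist (\<phi> (\<gamma> t)) (\<beta> t) \<le> K + 1" "\<gamma> 0 = b"
    by (metis order_refl)
  then have "LA_qi_embedding_on (L * L1) (L * (A1 + 2 * (K + 1) + A)) {0..} \<gamma>"
    using K(2) by (intro LA_qi_embedding_on_lift[OF q(1) \<phi>]) auto
  then show ?thesis using \<gamma> by (auto simp: quasi_geodesic_ray_def)
qed

text \<open>A lift of the chosen geodesic is a quasi-geodesic whose image again represents the
  class. That image is therefore contracting, and contraction pulls back to the lift.\<close>

lemma in_boundary_map_image:
  assumes \<eta>: "\<eta> \<in> X'" and K: "\<And>t. t \<ge> 0 \<Longrightarrow> infdist (\<alpha>' \<eta> t) (range \<phi>) \<le> K"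
  shows "\<eta> \<in> F ` X"
proof -
  note g = choice_mem(3,4)[OF \<eta>]
  have K0: "K \<ge> 0" using K[of 0] infdist_nonneg[of "\<alpha>' \<eta> 0" "range \<phi>"] by linarith
  obtain \<gamma> where \<gamma>: "quasi_geodesic_ray b (L * 1) (L * (0 + 2 * (K + 1) + A)) \<gamma>"
      "\<And>t. t \<ge> 0 \<Longrightarrow> dist (\<phi> (\<gamma> t)) (\<alpha>' \<eta> t) \<le> K + 1"
    using quasi_geodesic_ray_lift[OF geodesic_rayD(5)[OF g(2)] K K0] by blast
  have fh: "finite_hausdorff_distance (\<alpha>' \<eta> ` {0..}) ((\<phi> \<circ> \<gamma>) ` {0..})"
    using \<gamma>(2) by (intro finite_hausdorff_distance_pointwise[of _ _ _ "K + 1"]) (auto simp: dist_commute)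
  have "\<phi> \<circ> \<gamma> \<in> \<eta>"
    by (rule contracting_boundary_mem[OF \<eta> g(1) quasi_geodesic_ray_image[OF \<gamma>(1)] fh])
  then have \<phi>\<gamma>: "\<phi> \<circ> \<gamma> \<in> contracting_rays (\<phi> b)" "\<eta> = asymptotic (\<phi> b) `` {\<phi> \<circ> \<gamma>}"
    using contracting_boundaryD[OF \<eta>] by auto
  have "contracting (\<gamma> ` {0..})"
    using \<phi>\<gamma>(1) by (intro contracting_qi_preimage[OF \<phi>]) (auto simp: contracting_rays_def image_comp)
  then have "\<gamma> \<in> contracting_rays b" using \<gamma>(1) by (auto simp: contracting_rays_def)
  then show ?thesis
    using boundary_map_class \<phi>\<gamma>(2) class_in_contracting_boundary(1) by blast
qed

section \<open>Comparison of neighbourhoods in the two boundaries\<close>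

lemma choice_hausdorff:
  assumes \<zeta>: "\<zeta> \<in> X"
  obtains H where "\<And>x. \<bar>infdist x (\<phi> ` \<alpha> \<zeta> ` {0..}) - infdist x (\<alpha>' (F \<zeta>) ` {0..})\<bar> \<le> H" "H \<ge> 0"
proof -
  have F: "F \<zeta> \<in> X'" by (rule boundary_map_in[OF \<zeta>])
  have "finite_hausdorff_distance ((\<phi> \<circ> \<alpha> \<zeta>) ` {0..}) (\<alpha>' (F \<zeta>) ` {0..})"
    by (rule contracting_boundary_hausdorff[OF F boundary_map_mem[OF \<zeta> choice_mem(1)[OF \<zeta>]] choice_mem(3)[OF F]])
  then obtain H where H: "\<And>x. \<bar>infdist x (\<phi> ` \<alpha> \<zeta> ` {0..}) - infdist x (\<alpha>' (F \<zeta>) ` {0..})\<bar> \<le> H"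
    using finite_hausdorff_distance_infdist by (fastforce simp: image_comp)
  moreover have "H \<ge> 0" using H[of undefined] by linarith
  ultimately show thesis using that by blast
qed

text \<open>A test ray in an image class is lifted with constants that depend on \<open>r\<close>
  but not on the class. The lift comes near the chosen geodesic of \<open>\<zeta>\<close> far out,
  and its image carries this over to the target. \<open>H\<close> accounts for the chosen geodesic
  of the image class being different from the image of the chosen geodesic.\<close>

lemma boundary_map_nbhd:
  assumes \<zeta>: "\<zeta> \<in> X" and r: "r \<ge> 1"
  shows "\<exists>R\<ge>1. F ` U \<zeta> R \<subseteq> U' (F \<zeta>) r"
proof -
  obtain H where H: "\<And>x. \<bar>infdist x (\<phi> ` \<alpha> \<zeta> ` {0..}) - infdist x (\<alpha>' (F \<zeta>) ` {0..})\<bar> \<le> H" "H \<ge> 0"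
    using choice_hausdorff[OF \<zeta>] by blast
  obtain K where K: "K \<ge> 0" "\<And>\<beta> B. quasi_geodesic_ray (\<phi> b) r r \<beta> \<Longrightarrow> continuous_on {0..} \<beta> \<Longrightarrow>
    (\<forall>t\<ge>0. infdist (\<beta> t) (range \<phi>) \<le> B) \<Longrightarrow> (\<forall>t\<ge>0. infdist (\<beta> t) (range \<phi>) \<le> K)"
    using quasi_geodesic_ray_near_range[of r r] by metis
  obtain C where C: "C \<ge> 0" "\<And>R \<eta> \<beta>. \<eta> \<in> U \<zeta> R \<Longrightarrow> \<beta> \<in> \<eta> \<Longrightarrow>
      quasi_geodesic_ray b (L * r) (L * (r + 2 * (K + 1) + A)) \<beta> \<Longrightarrow>
      \<exists>t\<ge>0. infdist (\<beta> t) (\<alpha> \<zeta> ` {0..}) \<le> C \<and> R \<le> dist (\<beta> t) b + C"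
    using FQ_nbhdD[OF \<alpha> \<zeta>] by metis
  define C' where "C' = L * C + A + H + (K + 1)"
  have "C' \<ge> 0" using C(1) H(2) K(1) \<phi>D(1,2) by (simp add: C'_def)
  then obtain R' where R': "\<And>\<eta>. \<eta> \<in> X' \<Longrightarrow>
    (\<And>\<beta>. \<beta> \<in> \<eta> \<Longrightarrow> continuous_on {0..} \<beta> \<Longrightarrow> quasi_geodesic_ray (\<phi> b) r r \<beta> \<Longrightarrow>
      \<exists>t\<ge>0. infdist (\<beta> t) (\<alpha>' (F \<zeta>) ` {0..}) \<le> C' \<and> R' \<le> dist (\<beta> t) (\<phi> b)) \<Longrightarrow>
    \<eta> \<in> U' (F \<zeta>) r"
    using FQ_nbhd_criterion[OF \<alpha>' boundary_map_in[OF \<zeta>] r] by metis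
  \<comment> \<open>Read backwards: \<open>C\<close> is lost in \<open>FQ_nbhdD\<close>, the factor
    \<open>L\<close> and the summand \<open>A\<close> in passing from the lift to its image, and
    \<open>K + 1\<close> in passing from that image to \<open>\<beta>\<close>.\<close>
  define R where "R = max 1 (C + L * (R' + A + K + 1))"
  have "F \<eta> \<in> U' (F \<zeta>) r" if \<eta>: "\<eta> \<in> U \<zeta> R" for \<eta>
  proof (rule R')
    have \<eta>X: "\<eta> \<in> X" using \<eta> by (simp add: FQ_nbhd_def)
    show F\<eta>: "F \<eta> \<in> X'" by (rule boundary_map_in[OF \<eta>X])
    fix \<beta> assume \<beta>: "\<beta> \<in> F \<eta>" "continuous_on {0..} \<beta>" "quasi_geodesic_ray (\<phi> b) r r \<beta>"
    obtain B where "\<forall>s\<in>\<beta> ` {0..}. \<exists>t\<in>(\<phi> \<circ> \<alpha> \<eta>) ` {0..}. dist s t \<le> B"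
      using contracting_boundary_hausdorff[OF F\<eta> \<beta>(1) boundary_map_mem[OF \<eta>X choice_mem(1)[OF \<eta>X]]]
      unfolding finite_hausdorff_distance_def by blast
    then have "\<forall>t\<ge>0. infdist (\<beta> t) (range \<phi>) \<le> B"
      by (fastforce intro: infdist_le2)
    then have near: "\<And>t. t \<ge> 0 \<Longrightarrow> infdist (\<beta> t) (range \<phi>) \<le> K" using K(2)[OF \<beta>(3,2)] by blast
    obtain \<gamma> where \<gamma>: "quasi_geodesic_ray b (L * r) (L * (r + 2 * (K + 1) + A)) \<gamma>"
        "\<And>t. t \<ge> 0 \<Longrightarrow> dist (\<phi> (\<gamma> t)) (\<beta> t) \<le> K + 1"
      using quasi_geodesic_ray_lift[OF \<beta>(3) near K(1)] by blast
    have "finite_hausdorff_distance (\<beta> ` {0..}) ((\<phi> \<circ> \<gamma>) ` {0..})"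
      using \<gamma>(2) by (intro finite_hausdorff_distance_pointwise[of _ _ _ "K + 1"]) (auto simp: dist_commute)
    then have "\<gamma> \<in> \<eta>" by (rule boundary_map_mem_back[OF \<eta>X \<gamma>(1) \<beta>(1)])
    then obtain t where t: "t \<ge> 0" "infdist (\<gamma> t) (\<alpha> \<zeta> ` {0..}) \<le> C" "R \<le> dist (\<gamma> t) b + C"
      using C(2)[OF \<eta> _ \<gamma>(1)] by blast
    have "infdist (\<phi> (\<gamma> t)) (\<phi> ` \<alpha> \<zeta> ` {0..}) \<le> L * infdist (\<gamma> t) (\<alpha> \<zeta> ` {0..}) + A"
      by (rule infdist_qi_image_le(1)[OF \<phi>]) simp
    moreover have "L * infdist (\<gamma> t) (\<alpha> \<zeta> ` {0..}) \<le> L * C" using t(2) \<phi>D(1) by (intro mult_left_mono) auto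
    ultimately have "infdist (\<beta> t) (\<alpha>' (F \<zeta>) ` {0..}) \<le> C'"
      using H(1)[of "\<beta> t"] \<gamma>(2)[OF t(1)] infdist_triangle'[of "\<beta> t" "\<phi> ` \<alpha> \<zeta> ` {0..}" "\<phi> (\<gamma> t)"]
      unfolding C'_def by linarith
    moreover have "L * (R' + A + K + 1) \<le> L * (dist (\<phi> (\<gamma> t)) (\<phi> b) + A)"
      using t(3) \<phi>D(4)[of "\<gamma> t" b] by (simp add: R_def)
    then have "R' + K + 1 \<le> dist (\<phi> (\<gamma> t)) (\<phi> b)" using \<phi>D(1) by simp
    then have "R' \<le> dist (\<beta> t) (\<phi> b)"
      using \<gamma>(2)[OF t(1)] dist_triangle[of "\<phi> (\<gamma> t)" "\<phi> b" "\<beta> t"] by linarith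
    ultimately show "\<exists>t\<ge>0. infdist (\<beta> t) (\<alpha>' (F \<zeta>) ` {0..}) \<le> C' \<and> R' \<le> dist (\<beta> t) (\<phi> b)"
      using t(1) by blast
  qed
  then show ?thesis by (intro exI[of _ R]) (auto simp: R_def)
qed

text \<open>Only classes in the image are concerned, so no lifting is required: a test ray in the
  domain is pushed forward, with constants \<open>L * r\<close> and \<open>L * r + A\<close>, and
  the estimates for its image are pulled back. The image may be discontinuous, which
  \<open>FQ_nbhdD\<close> permits.\<close>

lemma boundary_map_nbhd_back:
  assumes \<zeta>: "\<zeta> \<in> X" and r: "r \<ge> 1"
  shows "\<exists>R\<ge>1. U' (F \<zeta>) R \<inter> F ` X \<subseteq> F ` U \<zeta> r"
proof -
  obtain H where H: "\<And>x. \<bar>infdist x (\<phi> ` \<alpha> \<zeta> ` {0..}) - infdist x (\<alpha>' (F \<zeta>) ` {0..})\<bar> \<le> H" "H \<ge> 0"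
    using choice_hausdorff[OF \<zeta>] by blast
  obtain C where C: "C \<ge> 0" "\<And>R \<eta> \<beta>. \<eta> \<in> U' (F \<zeta>) R \<Longrightarrow> \<beta> \<in> \<eta> \<Longrightarrow>
      quasi_geodesic_ray (\<phi> b) (L * r) (L * r + A) \<beta> \<Longrightarrow>
      \<exists>t\<ge>0. infdist (\<beta> t) (\<alpha>' (F \<zeta>) ` {0..}) \<le> C \<and> R \<le> dist (\<beta> t) (\<phi> b) + C"
    using FQ_nbhdD[OF \<alpha>' boundary_map_in[OF \<zeta>]] by metis
  define C' where "C' = L * (C + H + A)"
  have "C' \<ge> 0" using C(1) H(2) \<phi>D(1,2) by (simp add: C'_def)
  then obtain R' where R': "\<And>\<eta>. \<eta> \<in> X \<Longrightarrow>
    (\<And>\<beta>. \<beta> \<in> \<eta> \<Longrightarrow> continuous_on {0..} \<beta> \<Longrightarrow> quasi_geodesic_ray b r r \<beta> \<Longrightarrow>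
      \<exists>t\<ge>0. infdist (\<beta> t) (\<alpha> \<zeta> ` {0..}) \<le> C' \<and> R' \<le> dist (\<beta> t) b) \<Longrightarrow>
    \<eta> \<in> U \<zeta> r"
    using FQ_nbhd_criterion[OF \<alpha> \<zeta> r] by metis
  define R where "R = max 1 (C + A + L * R')"
  have "\<eta> \<in> U \<zeta> r" if \<eta>X: "\<eta> \<in> X" and \<eta>: "F \<eta> \<in> U' (F \<zeta>) R" for \<eta>
  proof (rule R'[OF \<eta>X])
    fix \<beta> assume \<beta>: "\<beta> \<in> \<eta>" "continuous_on {0..} \<beta>" "quasi_geodesic_ray b r r \<beta>"
    obtain t where t: "t \<ge> 0" "infdist (\<phi> (\<beta> t)) (\<alpha>' (F \<zeta>) ` {0..}) \<le> C" "R \<le> dist (\<phi> (\<beta> t)) (\<phi> b) + C"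
      using C(2)[OF \<eta> boundary_map_mem[OF \<eta>X \<beta>(1)] quasi_geodesic_ray_image[OF \<beta>(3)]] by auto
    have "infdist (\<beta> t) (\<alpha> \<zeta> ` {0..}) \<le> L * (infdist (\<phi> (\<beta> t)) (\<phi> ` \<alpha> \<zeta> ` {0..}) + A)"
      by (rule infdist_qi_image_le(2)[OF \<phi>]) simp
    also have "\<dots> \<le> C'"
      unfolding C'_def using t(2) H(1)[of "\<phi> (\<beta> t)"] \<phi>D(1) by (intro mult_left_mono) auto
    finally have "infdist (\<beta> t) (\<alpha> \<zeta> ` {0..}) \<le> C'" .
    moreover have "L * R' \<le> L * dist (\<beta> t) b"
      using t(3) \<phi>D(3)[of "\<beta> t" b] by (simp add: R_def)
    then have "R' \<le> dist (\<beta> t) b" using \<phi>D(1) by simp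
    ultimately show "\<exists>t\<ge>0. infdist (\<beta> t) (\<alpha> \<zeta> ` {0..}) \<le> C' \<and> R' \<le> dist (\<beta> t) b"
      using t(1) by blast
  qed
  then show ?thesis by (intro exI[of _ R]) (auto simp: R_def)
qed

text \<open>If image classes occurred in every neighbourhood, the images of their chosen geodesics,
  all quasi-geodesics with the same constants, would come within one fixed distance \<open>C\<close>
  of the chosen geodesic of \<open>\<eta>'\<close> arbitrarily far out. These returns to the range
  confine the whole geodesic near it.\<close>

lemma closed_boundary_map_image:
  assumes \<eta>': "\<eta>' \<in> X'" "\<eta>' \<notin> F ` X"
  shows "\<exists>R\<ge>1. U' \<eta>' R \<inter> F ` X = {}"
proof (rule ccontr)
  assume "\<not> ?thesis"
  then have meets: "\<exists>\<eta>\<in>X. F \<eta> \<in> U' \<eta>' R" if "R \<ge> 1" for R using that by blast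
  note g = choice_mem(3,4)[OF \<eta>'(1)]
  note gD = geodesic_rayD[OF g(2)]
  obtain C where C: "C \<ge> 0" "\<And>R \<eta> \<beta>. \<eta> \<in> U' \<eta>' R \<Longrightarrow> \<beta> \<in> \<eta> \<Longrightarrow>
      quasi_geodesic_ray (\<phi> b) (L * 1) (L * 0 + A) \<beta> \<Longrightarrow>
      \<exists>t\<ge>0. infdist (\<beta> t) (\<alpha>' \<eta>' ` {0..}) \<le> C \<and> R \<le> dist (\<beta> t) (\<phi> b) + C"
    using FQ_nbhdD[OF \<alpha>' \<eta>'(1)] by metis
  have returns: "\<exists>s\<ge>T. infdist (\<alpha>' \<eta>' s) (range \<phi>) \<le> C + 1" if T: "T \<ge> 0" for T
  proof -
    \<comment> \<open>One \<open>C\<close> is lost in the distance bound from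
      \<open>FQ_nbhdD\<close>, and \<open>C + 1\<close> in moving from the image point to a nearby
      point of the geodesic, which leaves parameter at least \<open>T\<close>.\<close>
    obtain \<eta> where \<eta>: "\<eta> \<in> X" "F \<eta> \<in> U' \<eta>' (T + 2 * C + 1)" using meets[of "T + 2 * C + 1"] T C(1) by auto
    note q = quasi_geodesic_ray_image[OF geodesic_rayD(5)[OF choice_mem(2)[OF \<eta>(1)]]]
    obtain t where t: "t \<ge> 0" "infdist (\<phi> (\<alpha> \<eta> t)) (\<alpha>' \<eta>' ` {0..}) \<le> C"
        "T + 2 * C + 1 \<le> dist (\<phi> (\<alpha> \<eta> t)) (\<phi> b) + C"
      using C(2)[OF \<eta>(2) boundary_map_mem[OF \<eta>(1) choice_mem(1)[OF \<eta>(1)]] q] by auto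
    obtain s where s: "s \<ge> 0" "dist (\<phi> (\<alpha> \<eta> t)) (\<alpha>' \<eta>' s) < C + 1"
      using infdist_less_obtain[of "\<phi> (\<alpha> \<eta> t)" "\<alpha>' \<eta>' ` {0..}" "C + 1"] t(2) by auto
    have "T \<le> s"
      using t(3) s(2) gD(4)[OF s(1)] dist_triangle[of "\<phi> (\<alpha> \<eta> t)" "\<phi> b" "\<alpha>' \<eta>' s"] by linarith
    moreover have "infdist (\<alpha>' \<eta>' s) (range \<phi>) \<le> C + 1"
      using s(2) by (intro infdist_le2[of "\<phi> (\<alpha> \<eta> t)"]) (auto simp: dist_commute)
    ultimately show ?thesis by blast
  qed
  obtain \<rho> where \<rho>: "sublinear \<rho>" "rho_contracting \<rho> (closure (range \<phi>))" "closure (range \<phi>) \<noteq> {}"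
    by (rule contracting_rangeE)
  have start: "infdist (\<alpha>' \<eta>' 0) (closure (range \<phi>)) \<le> kappa \<rho> 1 0"
    using gD(3) kappa_ge(1)[of 0 \<rho> 1] by simp
  have "infdist (\<alpha>' \<eta>' t) (range \<phi>) \<le> nbhd_bound \<rho> 1 0 (max (C + 1) (kappa \<rho> 1 0))" if t: "t \<ge> 0" for t
  proof -
    obtain s where "s \<ge> t" "infdist (\<alpha>' \<eta>' s) (range \<phi>) \<le> C + 1" using returns[OF t] by blast
    then show ?thesis
      using continuous_quasi_geodesic_near_contracting[OF \<rho> gD(1,2) start t, of s "max (C + 1) (kappa \<rho> 1 0)"]
      by simp
  qed
  then show False using in_boundary_map_image[OF \<eta>'(1)] \<eta>'(2) by blast
qed

lemma embedding_map_boundary_map: "embedding_map (FQ_topology b \<alpha>) (FQ_topology (\<phi> b) \<alpha>') F"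
  unfolding embedding_map_def topspace_FQ_topology[OF \<alpha>]
proof (rule bijective_open_imp_homeomorphic_map)
  have FX: "F ` X \<subseteq> X'" using boundary_map_in by auto
  note tops = topspace_FQ_topology[OF \<alpha>] topspace_FQ_topology[OF \<alpha>']
  show "continuous_map (FQ_topology b \<alpha>) (subtopology (FQ_topology (\<phi> b) \<alpha>') (F ` X)) F"
    unfolding continuous_map_in_subtopology
  proof (intro conjI)
    show "continuous_map (FQ_topology b \<alpha>) (FQ_topology (\<phi> b) \<alpha>') F"
      unfolding continuous_map_def tops
    proof (intro conjI allI impI)
      show "F \<in> X \<rightarrow> X'" using boundary_map_in by auto
      fix V assume "openin (FQ_topology (\<phi> b) \<alpha>') V"
      then have V: "\<And>\<zeta>. \<zeta> \<in> V \<Longrightarrow> \<exists>r\<ge>1. U' \<zeta> r \<subseteq> V" by (simp add: openin_FQ_topology[OF \<alpha>'])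
      show "openin (FQ_topology b \<alpha>) {x \<in> X. F x \<in> V}"
        unfolding openin_FQ_topology[OF \<alpha>]
      proof (intro conjI ballI)
        fix \<zeta> assume \<zeta>: "\<zeta> \<in> {x \<in> X. F x \<in> V}"
        then obtain r where r: "r \<ge> 1" "U' (F \<zeta>) r \<subseteq> V" using V by blast
        then obtain R where "R \<ge> 1" "F ` U \<zeta> R \<subseteq> U' (F \<zeta>) r" using boundary_map_nbhd \<zeta> by blast
        moreover have "U \<zeta> R \<subseteq> X" by (auto simp: FQ_nbhd_def)
        ultimately show "\<exists>r\<ge>1. U \<zeta> r \<subseteq> {x \<in> X. F x \<in> V}" using r(2) by (intro exI[of _ R]) auto
      qed auto
    qed
  qed (auto simp: tops)
  show "open_map (FQ_topology b \<alpha>) (subtopology (FQ_topology (\<phi> b) \<alpha>') (F ` X)) F"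
    unfolding open_map_def
  proof (intro allI impI)
    fix W assume "openin (FQ_topology b \<alpha>) W"
    then have W: "W \<subseteq> X" "\<And>\<zeta>. \<zeta> \<in> W \<Longrightarrow> \<exists>r\<ge>1. U \<zeta> r \<subseteq> W" by (simp_all add: openin_FQ_topology[OF \<alpha>])
    have "openin (FQ_topology (\<phi> b) \<alpha>') (F ` W \<union> (X' - F ` X))"
      unfolding openin_FQ_topology[OF \<alpha>']
    proof (intro conjI ballI)
      show "F ` W \<union> (X' - F ` X) \<subseteq> X'" using FX W(1) by blast
      fix \<eta>' assume \<eta>'_mem: "\<eta>' \<in> F ` W \<union> (X' - F ` X)"
      have "\<exists>R\<ge>1. U' \<eta>' R \<inter> F ` X \<subseteq> F ` W" if \<eta>': "\<eta>' \<in> F ` W"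
      proof -
        obtain \<zeta> where \<zeta>: "\<zeta> \<in> W" "\<eta>' = F \<zeta>" using \<eta>' by blast
        obtain r where r: "r \<ge> 1" "U \<zeta> r \<subseteq> W" using W(2)[OF \<zeta>(1)] by blast
        obtain R where "R \<ge> 1" "U' (F \<zeta>) R \<inter> F ` X \<subseteq> F ` U \<zeta> r"
          using boundary_map_nbhd_back[OF _ r(1), of \<zeta>] \<zeta>(1) W(1) by blast
        then show ?thesis using \<zeta>(2) r(2) by (intro exI[of _ R]) blast
      qed
      moreover have "\<exists>R\<ge>1. U' \<eta>' R \<inter> F ` X \<subseteq> F ` W" if "\<eta>' \<in> X' - F ` X"
        using closed_boundary_map_image[of \<eta>'] that by (metis DiffE empty_subsetI)
      ultimately obtain R where R: "R \<ge> 1" "U' \<eta>' R \<inter> F ` X \<subseteq> F ` W"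
        using \<eta>'_mem by auto
      moreover have "U' \<eta>' R \<subseteq> X'" by (auto simp: FQ_nbhd_def)
      ultimately show "\<exists>R\<ge>1. U' \<eta>' R \<subseteq> F ` W \<union> (X' - F ` X)" by (intro exI[of _ R]) auto
    qed
    moreover have "F ` W = F ` X \<inter> (F ` W \<union> (X' - F ` X))" using W(1) by blast
    ultimately show "openin (subtopology (FQ_topology (\<phi> b) \<alpha>') (F ` X)) (F ` W)"
      using openin_subtopology_Int2 by metis
  qed
  show "F ` topspace (FQ_topology b \<alpha>) = topspace (subtopology (FQ_topology (\<phi> b) \<alpha>') (F ` X))"
    using FX by (auto simp: tops)
  show "inj_on F (topspace (FQ_topology b \<alpha>))"
    unfolding tops by (rule inj_on_boundary_map)
qed

end

text \<open>The identity is a coarse projection: it moves no point, and the contraction clause is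
  vacuous since no point has height \<open>K + 1\<close> or more.\<close>

lemma contracting_coarsely_dense:
  fixes Z :: "'a::proper_geodesic_space set"
  assumes "\<And>y. infdist y Z \<le> K" "Z \<noteq> {}"
  shows "contracting Z"
proof (rule coarse_contraction_imp_contracting[OF _ assms(2)])
  show "coarse_contraction {(Z, \<lambda>x. x)}"
  proof (rule coarse_contractionI[of 1 _ 1])
    show "\<exists>R. \<forall>Z' P x y. (Z', P) \<in> {(Z, \<lambda>x. x)} \<longrightarrow> R \<le> infdist x Z' \<longrightarrow>
      1 * dist x y \<le> infdist x Z' \<longrightarrow> dist (P x) (P y) \<le> \<epsilon> * infdist x Z'" for \<epsilon> :: real
    proof -
      have "\<not> K + 1 \<le> infdist x Z" for x using assms(1)[of x] by linarith
      then show ?thesis by (intro exI[of _ "K + 1"]) auto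
    qed
  qed (auto simp: infdist_nonneg)
qed

theorem corollary6p2:
  fixes \<phi> :: "'a::proper_geodesic_space \<Rightarrow> 'b::proper_geodesic_space"
    and b :: 'a
    and \<alpha> :: "(real \<Rightarrow> 'a) set \<Rightarrow> real \<Rightarrow> 'a"
    and \<alpha>' :: "(real \<Rightarrow> 'b) set \<Rightarrow> real \<Rightarrow> 'b"
  assumes "quasi_isometric_embedding \<phi>"
    and "geodesic_choice b \<alpha>"
    and "geodesic_choice (\<phi> b) \<alpha>'"
  shows "(contracting (range \<phi>) \<longrightarrow>
           embedding_map (FQ_topology b \<alpha>) (FQ_topology (\<phi> b) \<alpha>') (boundary_map b \<phi>)) \<and>
         (quasi_isometry \<phi> \<longrightarrow>
           homeomorphic_map (FQ_topology b \<alpha>) (FQ_topology (\<phi> b) \<alpha>') (boundary_map b \<phi>))"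
proof (intro conjI impI)
  obtain L A where LA: "LA_qi_embedding_on L A UNIV \<phi>"
    using assms(1) by (auto simp: quasi_isometric_embedding_def)
  have emb: "contracting_qi_embedding \<phi> b \<alpha> \<alpha>' L A" if "contracting (range \<phi>)"
    using LA assms(2,3) that by unfold_locales
  then show "embedding_map (FQ_topology b \<alpha>) (FQ_topology (\<phi> b) \<alpha>') (boundary_map b \<phi>)"
    if "contracting (range \<phi>)"
    using contracting_qi_embedding.embedding_map_boundary_map that by blast
  assume "quasi_isometry \<phi>"
  then obtain K where K: "\<And>y. infdist y (range \<phi>) \<le> K"
    unfolding quasi_isometry_def by blast
  then have "contracting (range \<phi>)" by (rule contracting_coarsely_dense) simp
  then interpret contracting_qi_embedding \<phi> b \<alpha> \<alpha>' L A by (rule emb)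
  \<comment> \<open>Every geodesic ray of the target stays within \<open>K\<close> of the range, so
    every class has a lift.\<close>
  have "F ` X = X'"
    using in_boundary_map_image[OF _ K] boundary_map_in by blast
  then show "homeomorphic_map (FQ_topology b \<alpha>) (FQ_topology (\<phi> b) \<alpha>') (boundary_map b \<phi>)"
    using embedding_map_boundary_map surjective_embedding_map
    by (metis topspace_FQ_topology[OF \<alpha>] topspace_FQ_topology[OF \<alpha>'])
qed

end
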